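(* Let $\beta>1$ and $\mathbf{L}\in Q^2(\mathbb{D}^2)$. An analytic function $F\colon\mathbb{D}^2\to\mathbb{C}$ has bounded $\mathbf{L}$-index in joint variables if and only if there exists $p\in\mathbb{Z}_+$ such that for every $d\in(0,\beta]$ there exists $\eta(d)\in(0,d)$ such that for each $z^0\in\mathbb{D}^2$, for some $r=r(d,z^0)\in(\eta(d),d)$ and some $k^0=k^0(d,z^0)\le p$, the polynomial $p_{k^0}$ is a main polynomial in the diagonal power expansion of $F$ at $z^0$ on $\mathbb{T}^2\big(z^0,\frac{R}{\mathbf{L}(z^0)}\big)$ with $R=(r,r)$.
   Context: $\mathbb{D}^2=\{(z_1,z_2)\in\mathbb{C}^2:|z_1|<1,|z_2|<1\}$, $\mathbb{Z}_+=\{0,1,2,\dots\}$, $\mathbb{R}_+=[0,\infty)$. $\mathbf{L}(z)=(l_1(z),l_2(z))$, where each $l_j\colon\mathbb{D}^2\to\mathbb{R}_+$ is continuous and satisfies $l_j(z_1,z_2)>\beta/(1-|z_j|)$ for all $(z_1,z_2)\in\mathbb{D}^2$, $j=1,2$. For $z^0\in\mathbb{C}^2$ and $R=(r_1,r_2)\in\mathbb{R}_+^2$: $\mathbb{D}^2[z^0,R]=\{z:|z_j-z_j^0|\le r_j,\ j=1,2\}$, $\mathbb{T}^2(z^0,R)=\{z:|z_j-z_j^0|=r_j,\ j=1,2\}$, $\frac{R}{\mathbf{L}(z^0)}=\big(\frac{r_1}{l_1(z^0)},\frac{r_2}{l_2(z^0)}\big)$. $F^{(p,q)}=\frac{\partial^{p+q}F}{\partial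 z_1^p\partial z_2^q}$. An analytic $F\colon\mathbb{D}^2\to\mathbb{C}$ has bounded $\mathbf{L}$-index in joint variables if there is $n_0\in\mathbb{Z}_+$ such that for all $z\in\mathbb{D}^2$ and all $(p_1,p_2)\in\mathbb{Z}_+^2$: $\frac{|F^{(p_1,p_2)}(z)|}{p_1!p_2!\,l_1^{p_1}(z)l_2^{p_2}(z)}\le\max\{\frac{|F^{(k_1,k_2)}(z)|}{k_1!k_2!\,l_1^{k_1}(z)l_2^{k_2}(z)}:0\le k_1+k_2\le n_0\}$. $Q^2(\mathbb{D}^2)$ is the class of such $\mathbf{L}$ for which, for all $R=(r_1,r_2)\in[0,\beta]^2$ and $j=1,2$, $0<\lambda_{1,j}(R)\le\lambda_{2,j}(R)<\infty$, where $\lambda_{1,j}(R)=\inf_{z^0\in\mathbb{D}^2}\inf\{l_j(z)/l_j(z^0): z\in\mathbb{D}^2[z^0,R/\mathbf{L}(z^0)]\}$ and $\lambda_{2,j}(R)=\sup_{z^0\in\mathbb{D}^2}\sup\{l_j(z)/l_j(z^0): z\in\mathbb{D}^2[z^0,R/\mathbf{L}(z^0)]\}$. Diagonal power expansion: for $z^0\in\mathbb{D}^2$ write $F(z)=\sum_{k=0}^\infty p_k(z_1-z_1^0,z_2-z_2^0)$, where $p_k(w_1,w_2)=\sum_{j_1+j_2=k}b_{j_1,j_2}w_1^{j_1}w_2^{j_2}$ and $b_{j_1,j_2}=\frac{F^{(j_1,j_2)}(z^0)}{j_1!j_2!}$. For $R=(r_1,r_2)$, the polynomial $p_{k^0}$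 ($k^0\in\mathbb{Z}_+$) is a main polynomial of this expansion on $\mathbb{T}^2(z^0,R)$ if for every $z\in\mathbb{T}^2(z^0,R)$: $\big|\sum_{k\ne k^0}p_k(z_1-z_1^0,z_2-z_2^0)\big|\le\frac12\max\{|b_{j_1,j_2}|r_1^{j_1}r_2^{j_2}: j_1+j_2=k^0\}$. *)

theory Defs
  imports "HOL-Analysis.Analysis"
begin

definition bidisc :: "(complex \<times> complex) set" where
  "bidisc = {z. norm (fst z) < 1 \<and> norm (snd z) < 1}"

definition cpolydisc :: "complex \<times> complex \<Rightarrow> real \<times> real \<Rightarrow> (complex \<times> complex) set" where
  "cpolydisc z0 R = {z. norm (fst z - fst z0) \<le> fst R \<and> norm (snd z - snd z0) \<le> snd R}"

definition torus2 :: "complex \<times> complex \<Rightarrow> real \<times> real \<Rightarrow> (complex \<times> complex) set" where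
  "torus2 z0 R = {z. norm (fst z - fst z0) = fst R \<and> norm (snd z - snd z0) = snd R}"

text \<open>Analytic (holomorphic) on an open set of C^2: continuous and holomorphic in each
  variable separately (equivalent to local power series representability).\<close>
definition analytic2 :: "(complex \<times> complex \<Rightarrow> complex) \<Rightarrow> (complex \<times> complex) set \<Rightarrow> bool" where
  "analytic2 F S \<longleftrightarrow> continuous_on S F \<and>
     (\<forall>z\<in>S. (\<lambda>w. F (w, snd z)) holomorphic_on {w. (w, snd z) \<in> S}
           \<and> (\<lambda>w. F (fst z, w)) holomorphic_on {w. (fst z, w) \<in> S})"

definition pderiv2 :: "(complex \<times> complex \<Rightarrow> complex) \<Rightarrow> nat \<Rightarrow> nat \<Rightarrow> complex \<times> complex \<Rightarrow> complex" where
  "pderiv2 F p q z = (deriv ^^ p) (\<lambda>w1. (deriv ^^ q) (\<lambda>w2. F (w1, w2)) (snd z)) (fst z)"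

definition bounded_L_index_joint ::
  "(complex \<times> complex \<Rightarrow> complex) \<Rightarrow> (complex \<times> complex \<Rightarrow> real) \<Rightarrow> (complex \<times> complex \<Rightarrow> real) \<Rightarrow> bool" where
  "bounded_L_index_joint F l1 l2 \<longleftrightarrow>
     (\<exists>n0::nat. \<forall>z\<in>bidisc. \<forall>p1 p2::nat.
        norm (pderiv2 F p1 p2 z) / (fact p1 * fact p2 * l1 z ^ p1 * l2 z ^ p2)
        \<le> Max ((\<lambda>(k1, k2). norm (pderiv2 F k1 k2 z) / (fact k1 * fact k2 * l1 z ^ k1 * l2 z ^ k2))
                 ` {(k1, k2). k1 + k2 \<le> n0}))"

text \<open>lambda_{1,j}(R) and lambda_{2,j}(R), as extended reals; l selects l_j.\<close>
definition lambda1 :: "(complex \<times> complex \<Rightarrow> real) \<Rightarrow> (complex \<times> complex \<Rightarrow> real) \<Rightarrow> (complex \<times> complex \<Rightarrow> real) \<Rightarrow> real \<times> real \<Rightarrow> ereal" where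
  "lambda1 l l1 l2 R = (INF z0\<in>bidisc. INF z\<in>cpolydisc z0 (fst R / l1 z0, snd R / l2 z0). ereal (l z / l z0))"

definition lambda2 :: "(complex \<times> complex \<Rightarrow> real) \<Rightarrow> (complex \<times> complex \<Rightarrow> real) \<Rightarrow> (complex \<times> complex \<Rightarrow> real) \<Rightarrow> real \<times> real \<Rightarrow> ereal" where
  "lambda2 l l1 l2 R = (SUP z0\<in>bidisc. SUP z\<in>cpolydisc z0 (fst R / l1 z0, snd R / l2 z0). ereal (l z / l z0))"

definition Q2 :: "real \<Rightarrow> (complex \<times> complex \<Rightarrow> real) \<Rightarrow> (complex \<times> complex \<Rightarrow> real) \<Rightarrow> bool" where
  "Q2 \<beta> l1 l2 \<longleftrightarrow> (\<forall>r1 r2. 0 \<le> r1 \<and> r1 \<le> \<beta> \<and> 0 \<le> r2 \<and> r2 \<le> \<beta> \<longrightarrow>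
      (\<forall>l\<in>{l1, l2}. 0 < lambda1 l l1 l2 (r1, r2) \<and> lambda1 l l1 l2 (r1, r2) \<le> lambda2 l l1 l2 (r1, r2)
                     \<and> lambda2 l l1 l2 (r1, r2) < \<infinity>))"

definition tcoeff :: "(complex \<times> complex \<Rightarrow> complex) \<Rightarrow> complex \<times> complex \<Rightarrow> nat \<Rightarrow> nat \<Rightarrow> complex" where
  "tcoeff F z0 j1 j2 = pderiv2 F j1 j2 z0 / (fact j1 * fact j2)"

definition diag_poly :: "(complex \<times> complex \<Rightarrow> complex) \<Rightarrow> complex \<times> complex \<Rightarrow> nat \<Rightarrow> complex \<times> complex \<Rightarrow> complex" where
  "diag_poly F z0 k w = (\<Sum>j1\<le>k. tcoeff F z0 j1 (k - j1) * fst w ^ j1 * snd w ^ (k - j1))"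

definition main_polynomial :: "(complex \<times> complex \<Rightarrow> complex) \<Rightarrow> complex \<times> complex \<Rightarrow> real \<times> real \<Rightarrow> nat \<Rightarrow> bool" where
  "main_polynomial F z0 R k0 \<longleftrightarrow>
     (\<forall>z\<in>torus2 z0 R.
        norm (\<Sum>k. if k = k0 then 0 else diag_poly F z0 k (fst z - fst z0, snd z - snd z0))
        \<le> 1/2 * Max ((\<lambda>j1. norm (tcoeff F z0 j1 (k0 - j1)) * fst R ^ j1 * snd R ^ (k0 - j1)) ` {..k0}))"

end

theory Submission
  imports Defs "HOL-Complex_Analysis.Complex_Analysis"
begin

text \<open>
  Let $a_{j}(z) = |b_{j}(z)| / \mathbf{L}(z)^{j}$ be the scaled Taylor coefficients at $z$.

  If the index is at most $n$, put $A_k = \max_{|j| = k} a_j$; then every $A_k$ is at most some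
  $A_m$ with $m \le n$. For $r < 1$ the index of the largest $A_k r^k$ is therefore at most $n$, and
  it is monotone in $r$. Along a geometric progression of $n + 2$ radii it repeats, and at the
  geometric mean of two consecutive radii with the same index $k^0$ the terms $A_k r^k$ decay
  geometrically in $|k - k^0|$, which makes $p_{k^0}$ a main polynomial.

  Conversely, take $d = 1$. By Cauchy's inequalities a main polynomial of degree at most $p$ on a
  torus of scaled radius $r < 1$ gives $a_j r^{|j|} \le M(z) := \max_{|k| \le p} a_k(z)$ for all $j$. Hence
  $F$ is bounded by $9 M(z)$ on the polydisc of scaled radius $2r/3$, and Cauchy's inequalities give
  $M(w) \le K M(z)$ for $w$ at scaled distance at most $\eta/3$. A chain of boundedly many such steps
  reaches every point at scaled distance at most $\beta$, so $|F| \le K^N M(z)$ there and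
  $a_j(z) \le \beta^{-|j|} K^N M(z)$. Since $\beta > 1$, this is at most $M(z)$ for large $|j|$.
\<close>

section \<open>Double power series\<close>

lemma has_sum_geometric_nat:
  fixes x :: real
  assumes "0 \<le> x" "x < 1"
  shows "((\<lambda>n::nat. x ^ n) has_sum (1 / (1 - x))) UNIV"
  using assms by (intro sums_nonneg_imp_has_sum) (auto intro: geometric_sums)

lemma has_sum_geometric_product:
  fixes x y :: real
  assumes "0 \<le> x" "x < 1" "0 \<le> y" "y < 1"
  shows "((\<lambda>(p, q). x ^ p * y ^ q) has_sum (1 / (1 - x) * (1 / (1 - y)))) (UNIV :: (nat \<times> nat) set)"
proof -
  have inner: "((\<lambda>q. x ^ p * y ^ q) has_sum (x ^ p * (1 / (1 - y)))) UNIV" for p :: nat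
    by (intro has_sum_cmult_right has_sum_geometric_nat assms)
  have outer: "((\<lambda>p. x ^ p * (1 / (1 - y))) has_sum (1 / (1 - x) * (1 / (1 - y)))) (UNIV :: nat set)"
    by (intro has_sum_cmult_left has_sum_geometric_nat assms)
  have "(\<lambda>(p, q). x ^ p * y ^ q) summable_on (UNIV \<times> UNIV :: (nat \<times> nat) set)"
    by (rule summable_on_SigmaI[where g = "\<lambda>p. x ^ p * (1 / (1 - y))"])
       (use inner outer assms in \<open>auto simp: summable_on_def\<close>)
  then have "((\<lambda>(p, q). x ^ p * y ^ q) has_sum (1 / (1 - x) * (1 / (1 - y)))) (UNIV \<times> UNIV :: (nat \<times> nat) set)"
    by (intro has_sum_SigmaI[where g = "\<lambda>p. x ^ p * (1 / (1 - y))"]) (use inner outer in auto)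
  then show ?thesis by simp
qed

text \<open>Unconditional convergence permits regrouping along the antidiagonals
  \<open>p + q = k\<close>. This is the bridge from the double Taylor series to the diagonal
  expansion.\<close>

lemma sums_diagonals:
  fixes f :: "nat \<times> nat \<Rightarrow> complex"
  assumes "(f has_sum S) UNIV"
  shows "(\<lambda>k. \<Sum>j\<le>k. f (j, k - j)) sums S"
proof -
  let ?D = "Sigma (UNIV :: nat set) (\<lambda>k. {..k})"
  have "bij_betw (\<lambda>(k, j). (j, k - j)) ?D (UNIV :: (nat \<times> nat) set)"
    by (rule bij_betwI[where g = "\<lambda>(p, q). (p + q, p)"]) auto
  then have "((\<lambda>(k, j). f (j, k - j)) has_sum S) ?D"
    using assms has_sum_reindex_bij_betw[of "\<lambda>(k, j). (j, k - j)" ?D UNIV f S]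
    by (simp add: case_prod_unfold)
  then have "((\<lambda>k. \<Sum>j\<le>k. f (j, k - j)) has_sum S) UNIV"
    by (rule has_sum_SigmaD) (auto intro: has_sum_finite)
  then show ?thesis by (rule has_sum_imp_sums)
qed

text \<open>Absolute convergence is assumed on the closed disc and the bound on its boundary circle,
  so the sum is holomorphic inside, continuous up to the boundary, and open to the usual Cauchy
  estimate.\<close>

lemma power_series_Cauchy_inequality:
  fixes a :: "nat \<Rightarrow> complex"
  assumes sm: "summable (\<lambda>n. norm (a n) * \<rho> ^ n)" and "0 < \<rho>"
    and bd: "\<And>u. norm u = \<rho> \<Longrightarrow> norm (\<Sum>n. a n * u ^ n) \<le> B"
  shows "norm (a n) * \<rho> ^ n \<le> B"
proof -
  let ?f = "eval_fps (Abs_fps a)"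
  have f: "?f = (\<lambda>u. \<Sum>n. a n * u ^ n)"
    by (simp add: eval_fps_def fun_eq_iff)
  have "summable (\<lambda>n. a n * of_real \<rho> ^ n)"
    by (rule summable_norm_cancel) (use sm \<open>0 < \<rho>\<close> in \<open>simp add: norm_mult norm_power\<close>)
  then have "conv_radius a \<ge> norm (of_real \<rho> :: complex)"
    by (rule conv_radius_geI)
  then have rad: "fps_conv_radius (Abs_fps a) \<ge> ereal \<rho>"
    using \<open>0 < \<rho>\<close> by (simp add: fps_conv_radius_def)
  then have exp: "?f has_fps_expansion Abs_fps a"
    using \<open>0 < \<rho>\<close> by (intro has_fps_expansionI eval_fps_has_fps_expansion)
      (auto intro: less_le_trans[of _ "ereal \<rho>"])
  have hol: "?f holomorphic_on ball 0 \<rho>"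
  proof (rule holomorphic_on_eval_fps, rule subsetI)
    fix x assume "x \<in> ball (0::complex) \<rho>"
    then have "ereal (norm x) < ereal \<rho>" by simp
    also note rad
    finally show "x \<in> eball 0 (fps_conv_radius (Abs_fps a))" by simp
  qed
  \<comment> \<open>The radius of convergence may equal \<open>\<rho>\<close>, in which case
    holomorphy gives nothing on the circle; the M-test with majorant
    \<open>norm (a n) * \<rho> ^ n\<close> does.\<close>
  have "continuous_on (cball 0 \<rho>) ?f"
    unfolding f
  proof (rule uniform_limit_theorem)
    show "uniform_limit (cball 0 \<rho>) (\<lambda>n u. \<Sum>i<n. a i * u ^ i) (\<lambda>u. \<Sum>n. a n * u ^ n) sequentially"
      by (rule Weierstrass_m_test[OF _ sm])
         (auto simp: norm_mult norm_power intro!: mult_left_mono power_mono)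
  qed (auto intro!: continuous_intros always_eventually)
  then have "cmod ((deriv ^^ n) ?f 0) \<le> fact n * B / \<rho> ^ n"
    by (rule Cauchy_inequality[OF hol _ \<open>0 < \<rho>\<close>]) (use bd in \<open>auto simp: f\<close>)
  then have "cmod ((deriv ^^ n) ?f 0) / fact n \<le> B / \<rho> ^ n"
    by (simp add: field_simps)
  moreover have "norm (a n) = norm ((deriv ^^ n) ?f 0) / fact n"
    using arg_cong[OF fps_nth_fps_expansion[OF exp, of n], of norm] by (simp add: norm_divide)
  ultimately show ?thesis
    using \<open>0 < \<rho>\<close> by (simp add: pos_le_divide_eq)
qed

text \<open>The one-variable estimate is applied twice. For fixed \<open>u\<close> on the first
  circle it bounds the coefficients \<open>e u q\<close> of the series in \<open>v\<close>; each
  \<open>e u q\<close> is in turn a power series in \<open>u\<close> with coefficients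
  \<open>a p q\<close>.\<close>

lemma double_power_series_Cauchy_inequality:
  fixes a :: "nat \<Rightarrow> nat \<Rightarrow> complex"
  assumes sm: "(\<lambda>(p, q). norm (a p q) * \<rho>1 ^ p * \<rho>2 ^ q) summable_on UNIV"
    and pos: "0 < \<rho>1" "0 < \<rho>2"
    and bd: "\<And>u v. norm u = \<rho>1 \<Longrightarrow> norm v = \<rho>2 \<Longrightarrow>
      norm (infsum (\<lambda>(p, q). a p q * u ^ p * v ^ q) UNIV) \<le> B"
  shows "norm (a p q) * \<rho>1 ^ p * \<rho>2 ^ q \<le> B"
proof -
  \<comment> \<open>Swapping makes \<open>q\<close> the outer index, so that the inner sums over
    \<open>p\<close> are the series \<open>e u q\<close>.\<close>
  have sm': "(\<lambda>(q, p). norm (a p q) * \<rho>1 ^ p * \<rho>2 ^ q) summable_on UNIV \<times> UNIV"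
    using sm summable_on_swap[of "\<lambda>(p, q). norm (a p q) * \<rho>1 ^ p * \<rho>2 ^ q" UNIV UNIV] by simp
  have col': "(\<lambda>p. norm (a p q) * \<rho>1 ^ p * \<rho>2 ^ q) summable_on UNIV" for q
    using summable_on_SigmaD1[OF sm', of q] by simp
  have col: "summable (\<lambda>p. norm (a p q) * \<rho>1 ^ p)" for q
  proof -
    have "(\<lambda>p. (norm (a p q) * \<rho>1 ^ p * \<rho>2 ^ q) * (1 / \<rho>2 ^ q)) summable_on UNIV"
      by (intro summable_on_cmult_left col')
    then have "(\<lambda>p. norm (a p q) * \<rho>1 ^ p) summable_on UNIV"
      using pos by simp
    then show ?thesis by (rule summable_on_imp_summable)
  qed
  define e where "e u q = (\<Sum>p. a p q * u ^ p)" for u q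
  have e_bd: "norm (e u q) * \<rho>2 ^ q \<le> B" if u: "norm u = \<rho>1" for u q
  proof (rule power_series_Cauchy_inequality)
    have nc: "(\<lambda>p. norm (a p q * u ^ p)) summable_on UNIV" for q
      using col[of q] pos u
      by (subst summable_on_UNIV_nonneg_real_iff) (auto simp: norm_mult norm_power)
    have ne: "norm (e u q) * \<rho>2 ^ q \<le> (\<Sum>\<^sub>\<infinity>p. norm (a p q) * \<rho>1 ^ p * \<rho>2 ^ q)" for q
    proof -
      have "norm (e u q) \<le> (\<Sum>p. norm (a p q) * \<rho>1 ^ p)"
        unfolding e_def using col[of q] u summable_norm[of "\<lambda>p. a p q * u ^ p"]
        by (simp add: norm_mult norm_power)
      then have "norm (e u q) * \<rho>2 ^ q \<le> (\<Sum>p. norm (a p q) * \<rho>1 ^ p) * \<rho>2 ^ q"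
        using pos by (intro mult_right_mono) auto
      also have "\<dots> = (\<Sum>p. norm (a p q) * \<rho>1 ^ p * \<rho>2 ^ q)"
        using suminf_mult2[OF col] by simp
      also have "\<dots> = (\<Sum>\<^sub>\<infinity>p. norm (a p q) * \<rho>1 ^ p * \<rho>2 ^ q)"
        by (rule sums_unique[OF has_sum_imp_sums[OF has_sum_infsum[OF col']], symmetric])
      finally show ?thesis .
    qed
    have "(\<lambda>q. \<Sum>\<^sub>\<infinity>p. norm (a p q) * \<rho>1 ^ p * \<rho>2 ^ q) summable_on UNIV"
      using summable_on_Sigma_banach[OF sm'] .
    then show "summable (\<lambda>n. norm (e u n) * \<rho>2 ^ n)"
      by (intro summable_comparison_test'[OF summable_on_imp_summable, of _ 0])
         (use ne pos in \<open>auto simp: norm_mult\<close>)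
    show "norm (\<Sum>n. e u n * v ^ n) \<le> B" if v: "norm v = \<rho>2" for v
    proof -
      have "(\<lambda>(q, p). norm (a p q * u ^ p * v ^ q)) summable_on UNIV \<times> UNIV"
        using sm' u v by (simp add: norm_mult norm_power)
      then have s1: "(\<lambda>(q, p). a p q * u ^ p * v ^ q) summable_on UNIV \<times> UNIV"
        using abs_summable_summable[of "\<lambda>(q, p). a p q * u ^ p * v ^ q"] by (simp add: case_prod_unfold)
      have inner: "((\<lambda>p. a p q * u ^ p * v ^ q) has_sum (e u q * v ^ q)) UNIV" for q
      proof -
        have "((\<lambda>p. a p q * u ^ p) has_sum e u q) UNIV"
          unfolding e_def using nc[of q]
          by (intro norm_summable_imp_has_sum summable_sums summable_norm_cancel[of "\<lambda>p. a p q * u ^ p"])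
             (auto intro: summable_on_imp_summable)
        then show ?thesis by (rule has_sum_cmult_left)
      qed
      have "((\<lambda>q. e u q * v ^ q) has_sum infsum (\<lambda>(q, p). a p q * u ^ p * v ^ q) (UNIV \<times> UNIV)) UNIV"
        by (rule has_sum_SigmaD[OF has_sum_infsum[OF s1]]) (use inner in auto)
      then have "(\<Sum>q. e u q * v ^ q) = infsum (\<lambda>(q, p). a p q * u ^ p * v ^ q) (UNIV \<times> UNIV)"
        by (rule sums_unique[OF has_sum_imp_sums, symmetric])
      also have "\<dots> = infsum (\<lambda>(p, q). a p q * u ^ p * v ^ q) (UNIV \<times> UNIV)"
        using infsum_reindex_bij_betw[of prod.swap "UNIV \<times> UNIV" "UNIV \<times> UNIV" "\<lambda>(p, q). a p q * u ^ p * v ^ q"]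
        by (simp add: case_prod_unfold)
      finally show ?thesis using bd[OF u v] by simp
    qed
  qed (use pos in auto)
  have "norm (a p q) * \<rho>1 ^ p \<le> B / \<rho>2 ^ q"
    by (rule power_series_Cauchy_inequality[OF col])
       (use e_bd pos in \<open>auto simp: e_def field_simps\<close>)
  then show ?thesis using pos by (simp add: field_simps)
qed

section \<open>Taylor expansion on the bidisc\<close>

lemma analytic2_bidisc_sections:
  assumes "analytic2 F bidisc"
  shows "norm w < 1 \<Longrightarrow> (\<lambda>v. F (w, v)) holomorphic_on ball 0 1"
    and "norm v < 1 \<Longrightarrow> (\<lambda>w. F (w, v)) holomorphic_on ball 0 1"
proof -
  have "(\<lambda>v. F (w, v)) holomorphic_on {v. (w, v) \<in> bidisc}" if "norm w < 1"
    using assms that unfolding analytic2_def bidisc_def by force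
  moreover have "(\<lambda>w. F (w, v)) holomorphic_on {w. (w, v) \<in> bidisc}" if "norm v < 1"
    using assms that unfolding analytic2_def bidisc_def by force
  moreover have "{v. (w, v) \<in> bidisc} = ball 0 1" if "norm w < 1"
    using that by (auto simp: bidisc_def)
  moreover have "{w. (w, v) \<in> bidisc} = ball 0 1" if "norm v < 1"
    using that by (auto simp: bidisc_def)
  ultimately show "norm w < 1 \<Longrightarrow> (\<lambda>v. F (w, v)) holomorphic_on ball 0 1"
    and "norm v < 1 \<Longrightarrow> (\<lambda>w. F (w, v)) holomorphic_on ball 0 1"
    by simp_all
qed

lemma cball_subset_unit_disc:
  fixes z :: complex
  assumes "norm z + r < 1"
  shows "cball z r \<subseteq> ball 0 1"
proof
  fix w assume "w \<in> cball z r"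
  then have "norm (w - z) \<le> r" by (simp add: dist_norm norm_minus_commute)
  with assms norm_triangle_sub[of w z] show "w \<in> ball 0 1" by auto
qed

lemma analytic2_bounded_on_polydisc:
  assumes "analytic2 F bidisc" "cball z1 \<rho>1 \<subseteq> ball 0 1" "cball z2 \<rho>2 \<subseteq> ball 0 1"
  obtains M where "0 \<le> M"
    "\<And>w v. w \<in> cball z1 \<rho>1 \<Longrightarrow> v \<in> cball z2 \<rho>2 \<Longrightarrow> norm (F (w, v)) \<le> M"
proof -
  have "cball z1 \<rho>1 \<times> cball z2 \<rho>2 \<subseteq> bidisc"
    using assms(2,3) by (auto simp: bidisc_def subset_iff)
  then have "continuous_on (cball z1 \<rho>1 \<times> cball z2 \<rho>2) F"
    using assms(1) unfolding analytic2_def by (blast intro: continuous_on_subset)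
  then have "compact (F ` (cball z1 \<rho>1 \<times> cball z2 \<rho>2))"
    by (intro compact_continuous_image compact_Times compact_cball)
  then obtain M where "\<forall>x \<in> F ` (cball z1 \<rho>1 \<times> cball z2 \<rho>2). norm x \<le> M"
    using compact_imp_bounded bounded_iff by metis
  then show ?thesis
    by (intro that[of "max M 0"]) (auto simp: le_max_iff_disj)
qed

lemma higher_deriv_Cauchy_unit_disc:
  assumes "f holomorphic_on ball 0 1" "cball z \<rho> \<subseteq> ball 0 1" "0 < \<rho>"
    and "\<And>x. x \<in> cball z \<rho> \<Longrightarrow> norm (f x) \<le> M"
  shows "norm ((deriv ^^ n) f z / fact n) \<le> M / \<rho> ^ n"
proof -
  have "f holomorphic_on ball z \<rho>" "continuous_on (cball z \<rho>) f"
    using assms(1,2) ball_subset_cball holomorphic_on_subset holomorphic_on_imp_continuous_on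
    by (metis order_trans)+
  then have "cmod ((deriv ^^ n) f z) \<le> fact n * M / \<rho> ^ n"
    by (rule Cauchy_inequality[OF _ _ \<open>0 < \<rho>\<close>]) (use assms(4) in \<open>auto simp: dist_norm\<close>)
  then show ?thesis by (simp add: norm_divide field_simps)
qed

text \<open>The $q$-th Taylor coefficient in the second variable is the locally uniform limit, as
  $h \to 0$, of $h^{-q}$ times the Taylor remainder of order $q$ at $h$; by induction on $q$ these
  quotients are holomorphic in the first variable.\<close>
lemma higher_deriv_snd_holomorphic:
  assumes F: "analytic2 F bidisc" and z2: "norm z2 < 1"
  shows "(\<lambda>w. (deriv ^^ q) (\<lambda>v. F (w, v)) z2) holomorphic_on ball 0 1"
proof (induction q rule: less_induct)
  case (less q)
  define \<rho> where "\<rho> = (1 - norm z2) / 2"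
  have \<rho>: "0 < \<rho>" "cball z2 \<rho> \<subseteq> ball 0 1"
    using z2 by (auto simp: \<rho>_def field_simps intro!: cball_subset_unit_disc simp del: cball_subset_ball_iff)
  define c where "c n w = (deriv ^^ n) (\<lambda>v. F (w, v)) z2 / fact n" for n w
  \<comment> \<open>With this choice \<open>h m / \<rho> = 1 / (m + 2) = x\<close>, and the
    geometric tail is \<open>x / (1 - x) = 1 / (m + 1)\<close>. The summand 2 keeps
    \<open>h m\<close> strictly below \<open>\<rho>\<close> already at \<open>m = 0\<close>.\<close>
  define h where "h m = \<rho> / (real m + 2)" for m
  have h: "0 < h m" "h m < \<rho>" for m
    using \<rho>(1) by (auto simp: h_def field_simps add_pos_nonneg)
  define f where "f m w = (F (w, z2 + of_real (h m)) - (\<Sum>k<q. c k w * of_real (h m) ^ k)) / of_real (h m) ^ q" for m w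
  have "c q holomorphic_on ball 0 1"
  proof (rule holomorphic_uniform_sequence[where f = f])
    show "f m holomorphic_on ball 0 1" for m
    proof -
      have "norm (z2 + of_real (h m)) < 1"
        using \<rho>(2) h[of m] by (auto simp: subset_iff dist_norm)
      then show ?thesis
        unfolding f_def c_def using h[of m]
        by (intro holomorphic_intros analytic2_bidisc_sections(2)[OF F] less) auto
    qed
    fix x :: complex assume "x \<in> ball 0 1"
    then obtain d where d: "0 < d" "cball x d \<subseteq> ball 0 1"
      using open_ball open_contains_cball by blast
    obtain M where M: "0 \<le> M"
      "\<And>w v. w \<in> cball x d \<Longrightarrow> v \<in> cball z2 \<rho> \<Longrightarrow> norm (F (w, v)) \<le> M"
      using analytic2_bounded_on_polydisc[OF F d(2) \<rho>(2)] by metis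
    have err: "norm (f m w - c q w) \<le> M / \<rho> ^ q * (1 / real (Suc m))" if w: "w \<in> cball x d" for m w
    proof -
      have hol: "(\<lambda>v. F (w, v)) holomorphic_on ball 0 1"
        using w d(2) by (intro analytic2_bidisc_sections(1)[OF F]) auto
      have cb: "norm (c n w) \<le> M / \<rho> ^ n" for n
        unfolding c_def using M(2) w by (intro higher_deriv_Cauchy_unit_disc[OF hol \<rho>(2,1)]) auto
      let ?h = "of_real (h m) :: complex"
      have "(\<lambda>n. c n w * (z2 + ?h - z2) ^ n) sums F (w, z2 + ?h)"
        unfolding c_def
      proof (rule holomorphic_power_series[of "\<lambda>v. F (w, v)" z2 \<rho>])
        show "(\<lambda>v. F (w, v)) holomorphic_on ball z2 \<rho>"
          using hol \<rho>(2) ball_subset_cball by (blast intro: holomorphic_on_subset)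
      qed (use h[of m] in \<open>auto simp: dist_norm\<close>)
      then have "(\<lambda>n. c n w * ?h ^ n) sums F (w, z2 + ?h)" by simp
      then have "(\<lambda>n. c (n + q) w * ?h ^ (n + q)) sums (F (w, z2 + ?h) - (\<Sum>k<q. c k w * ?h ^ k))"
        by (rule sums_split_initial_segment)
      then have "(\<lambda>n. c (n + q) w * ?h ^ (n + q) / ?h ^ q) sums f m w"
        unfolding f_def by (rule sums_divide)
      then have "(\<lambda>n. c (n + q) w * ?h ^ n) sums f m w"
        using h[of m] by (simp add: power_add)
      \<comment> \<open>Removing one more term, the constant \<open>c q w\<close>, leaves exactly
        the error \<open>f m w - c q w\<close> as a series that starts with the first power of
        \<open>h m\<close>.\<close>
      then have "(\<lambda>n. c (n + Suc 0 + q) w * ?h ^ (n + Suc 0)) sums (f m w - (\<Sum>k<Suc 0. c (k + q) w * ?h ^ k))"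
        by (rule sums_split_initial_segment)
      then have s1: "(\<lambda>n. c (Suc n + q) w * ?h ^ Suc n) sums (f m w - c q w)" by simp
      let ?x = "1 / (real m + 2)"
      have s2: "(\<lambda>n. M / \<rho> ^ q * ?x * ?x ^ n) sums (M / \<rho> ^ q * ?x * (1 / (1 - ?x)))"
        by (intro sums_mult geometric_sums) auto
      have "norm (c (Suc n + q) w * ?h ^ Suc n) \<le> M / \<rho> ^ q * ?x * ?x ^ n" for n
      proof -
        have "norm (c (Suc n + q) w * ?h ^ Suc n) = norm (c (Suc n + q) w) * h m ^ Suc n"
          using h(1)[of m] by (simp add: norm_mult norm_power)
        also have "\<dots> \<le> M / \<rho> ^ (Suc n + q) * h m ^ Suc n"
          using h(1)[of m] by (intro mult_right_mono cb) auto
        also have "\<dots> = M / \<rho> ^ q * ?x * ?x ^ n"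
          using \<rho>(1) by (simp add: h_def power_add power_divide field_simps)
        finally show ?thesis .
      qed
      then have "norm (f m w - c q w) \<le> M / \<rho> ^ q * ?x * (1 / (1 - ?x))"
        using s1 s2 by (metis (no_types, lifting) norm_suminf_le sums_iff)
      also have "?x * (1 / (1 - ?x)) = 1 / real (Suc m)"
        by (simp add: field_simps)
      then have "M / \<rho> ^ q * ?x * (1 / (1 - ?x)) = M / \<rho> ^ q * (1 / real (Suc m))"
        by (simp only: mult.assoc)
      finally show ?thesis .
    qed
    have lim: "(\<lambda>m. M / \<rho> ^ q * (1 / real (Suc m))) \<longlonglongrightarrow> 0"
      using tendsto_mult_right_zero[OF LIMSEQ_inverse_real_of_nat, of "M / \<rho> ^ q"]
      by (simp only: inverse_eq_divide)
    have "uniform_limit (cball x d) f (c q) sequentially"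
    proof (rule uniform_limitI)
      fix e :: real assume "0 < e"
      with lim have "\<forall>\<^sub>F m in sequentially. M / \<rho> ^ q * (1 / real (Suc m)) < e"
        by (rule order_tendstoD(2))
      then show "\<forall>\<^sub>F m in sequentially. \<forall>w\<in>cball x d. dist (f m w) (c q w) < e"
        by eventually_elim (auto simp: dist_norm simp del: of_nat_Suc intro: le_less_trans[OF err])
    qed
    then show "\<exists>d>0. cball x d \<subseteq> ball 0 1 \<and> uniform_limit (cball x d) f (c q) sequentially"
      using d by blast
  qed auto
  then have "(\<lambda>w. c q w * fact q) holomorphic_on ball 0 1"
    by (intro holomorphic_intros)
  then show ?case by (simp add: c_def)
qed

text \<open>\<open>F\<close> is expanded in the second variable, and each coefficient
  \<open>c q\<close>, holomorphic in the first variable, is expanded again. Cauchy's inequalities on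
  a slightly larger polydisc give a product of geometric series as majorant, which justifies
  treating the iterated sum as an unordered double sum.\<close>

lemma tcoeff_abs_summable_and_sum:
  assumes F: "analytic2 F bidisc" and z: "z \<in> bidisc"
    and u: "norm u < 1 - norm (fst z)" and v: "norm v < 1 - norm (snd z)"
  shows "(\<lambda>(p, q). norm (tcoeff F z p q) * norm u ^ p * norm v ^ q) summable_on UNIV"
    and "((\<lambda>(p, q). tcoeff F z p q * u ^ p * v ^ q) has_sum F (fst z + u, snd z + v)) UNIV"
proof -
  obtain z1 z2 where z_eq: "z = (z1, z2)" by (cases z)
  have z1: "norm z1 < 1" and z2: "norm z2 < 1" using z by (auto simp: z_eq bidisc_def)
  obtain \<rho>1 \<rho>2 where \<rho>: "norm u < \<rho>1" "\<rho>1 < 1 - norm z1" "norm v < \<rho>2" "\<rho>2 < 1 - norm z2"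
    using dense[OF u] dense[OF v] by (auto simp: z_eq)
  have pos: "0 < \<rho>1" "0 < \<rho>2"
    using \<rho> norm_ge_zero[of u] norm_ge_zero[of v] by linarith+
  have sub: "cball z1 \<rho>1 \<subseteq> ball 0 1" "cball z2 \<rho>2 \<subseteq> ball 0 1"
    using \<rho> by (auto intro!: cball_subset_unit_disc simp del: cball_subset_ball_iff)
  obtain M where M: "0 \<le> M"
    "\<And>w v. w \<in> cball z1 \<rho>1 \<Longrightarrow> v \<in> cball z2 \<rho>2 \<Longrightarrow> norm (F (w, v)) \<le> M"
    using analytic2_bounded_on_polydisc[OF F sub] by metis
  define c where "c q w = (deriv ^^ q) (\<lambda>v. F (w, v)) z2 / fact q" for q w
  have c_hol: "c q holomorphic_on ball 0 1" for q
    unfolding c_def by (intro holomorphic_intros higher_deriv_snd_holomorphic[OF F z2]) auto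
  have c_bd: "norm (c q w) \<le> M / \<rho>2 ^ q" if "w \<in> cball z1 \<rho>1" for q w
    unfolding c_def
  proof (rule higher_deriv_Cauchy_unit_disc)
    show "(\<lambda>v. F (w, v)) holomorphic_on ball 0 1"
      using that sub(1) by (intro analytic2_bidisc_sections(1)[OF F]) auto
  qed (use pos sub M that in auto)
  \<comment> \<open>\<open>pderiv2\<close> differentiates in the second variable first, so the mixed
    coefficient is an iterated one-variable coefficient and no partial derivatives have to be
    interchanged.\<close>
  have tc: "tcoeff F z p q = (deriv ^^ p) (c q) z1 / fact p" for p q
  proof -
    have "(deriv ^^ p) (\<lambda>w. (1 / fact q) * (deriv ^^ q) (\<lambda>v. F (w, v)) z2) z1
        = (1 / fact q) * (deriv ^^ p) (\<lambda>w. (deriv ^^ q) (\<lambda>v. F (w, v)) z2) z1"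
      by (rule higher_deriv_cmult[OF higher_deriv_snd_holomorphic[OF F z2] _ open_ball])
         (use z1 in auto)
    then show ?thesis
      by (simp add: tcoeff_def pderiv2_def c_def[abs_def] z_eq)
  qed
  have tb: "norm (tcoeff F z p q) \<le> M / \<rho>2 ^ q / \<rho>1 ^ p" for p q
    unfolding tc by (rule higher_deriv_Cauchy_unit_disc[OF c_hol sub(1) pos(1)]) (rule c_bd)
  have "(\<lambda>x. M * (case x of (p, q) \<Rightarrow> (norm u / \<rho>1) ^ p * (norm v / \<rho>2) ^ q)) summable_on UNIV"
    using pos \<rho> by (intro summable_on_cmult_right has_sum_imp_summable[OF has_sum_geometric_product]) auto
  then show sm: "(\<lambda>(p, q). norm (tcoeff F z p q) * norm u ^ p * norm v ^ q) summable_on UNIV"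
  proof (rule summable_on_comparison_test)
    fix x :: "nat \<times> nat"
    obtain p q where x: "x = (p, q)" by (cases x)
    have "norm (tcoeff F z p q) * (norm u ^ p * norm v ^ q) \<le> (M / \<rho>2 ^ q / \<rho>1 ^ p) * (norm u ^ p * norm v ^ q)"
      by (intro mult_right_mono tb) auto
    then show "(case x of (p, q) \<Rightarrow> norm (tcoeff F z p q) * norm u ^ p * norm v ^ q)
        \<le> M * (case x of (p, q) \<Rightarrow> (norm u / \<rho>1) ^ p * (norm v / \<rho>2) ^ q)"
      by (simp add: x power_divide mult_ac)
  qed (auto split: prod.split)
  let ?g = "\<lambda>(q, p). tcoeff F z p q * u ^ p * v ^ q"
  have sm_swap: "(\<lambda>(q, p). norm (tcoeff F z p q) * norm u ^ p * norm v ^ q) summable_on UNIV \<times> UNIV"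
    using sm summable_on_swap[of "\<lambda>(p, q). norm (tcoeff F z p q) * norm u ^ p * norm v ^ q" UNIV UNIV] by simp
  then have "(\<lambda>x. norm (?g x)) summable_on UNIV \<times> UNIV"
    by (simp add: case_prod_unfold norm_mult norm_power)
  then have sm_g: "?g summable_on UNIV \<times> UNIV" by (rule abs_summable_summable)
  have inner: "((\<lambda>p. ?g (q, p)) has_sum (c q (z1 + u) * v ^ q)) UNIV" for q
  proof -
    have "(\<lambda>p. (deriv ^^ p) (c q) z1 / fact p * (z1 + u - z1) ^ p) sums c q (z1 + u)"
    proof (rule holomorphic_power_series[of _ z1 \<rho>1])
      show "c q holomorphic_on ball z1 \<rho>1"
        using c_hol sub(1) ball_subset_cball by (blast intro: holomorphic_on_subset)
    qed (use \<rho> in \<open>auto simp: dist_norm\<close>)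
    then have sums: "(\<lambda>p. tcoeff F z p q * u ^ p * v ^ q) sums (c q (z1 + u) * v ^ q)"
      by (intro sums_mult2) (simp add: tc)
    have "(\<lambda>p. ?g (q, p)) summable_on UNIV"
      using summable_on_SigmaD1[of "\<lambda>q p. ?g (q, p)" UNIV "\<lambda>_. UNIV" q] sm_g by simp
    then have "((\<lambda>p. ?g (q, p)) has_sum infsum (\<lambda>p. ?g (q, p)) UNIV) UNIV"
      by (rule has_sum_infsum)
    moreover from has_sum_imp_sums[OF this] have "infsum (\<lambda>p. ?g (q, p)) UNIV = c q (z1 + u) * v ^ q"
      using sums by (simp add: sums_iff)
    ultimately show ?thesis by simp
  qed
  \<comment> \<open>Fubini reduces the double sum to the series over \<open>q\<close>, whose value
    is known from the one-variable expansion of \<open>F\<close> along the slice with first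
    coordinate \<open>z1 + u\<close>.\<close>
  have "((\<lambda>q. c q (z1 + u) * v ^ q) has_sum infsum ?g (UNIV \<times> UNIV)) UNIV"
    by (rule has_sum_SigmaD[OF has_sum_infsum[OF sm_g]]) (use inner in auto)
  then have "(\<lambda>q. c q (z1 + u) * v ^ q) sums infsum ?g (UNIV \<times> UNIV)"
    by (rule has_sum_imp_sums)
  moreover have "(\<lambda>q. c q (z1 + u) * (z2 + v - z2) ^ q) sums F (z1 + u, z2 + v)"
    unfolding c_def
  proof (rule holomorphic_power_series[of "\<lambda>v. F (z1 + u, v)" z2 \<rho>2])
    have "z1 + u \<in> cball z1 \<rho>1" using \<rho> by (simp add: dist_norm)
    then have "(\<lambda>v. F (z1 + u, v)) holomorphic_on ball 0 1"
      using sub(1) by (intro analytic2_bidisc_sections(1)[OF F]) auto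
    then show "(\<lambda>v. F (z1 + u, v)) holomorphic_on ball z2 \<rho>2"
      using sub(2) ball_subset_cball by (blast intro: holomorphic_on_subset)
  qed (use \<rho> in \<open>auto simp: dist_norm\<close>)
  ultimately have "infsum ?g (UNIV \<times> UNIV) = F (z1 + u, z2 + v)"
    using sums_unique2 by simp
  then have "(?g has_sum F (z1 + u, z2 + v)) (UNIV \<times> UNIV)"
    using has_sum_infsum[OF sm_g] by simp
  then show "((\<lambda>(p, q). tcoeff F z p q * u ^ p * v ^ q) has_sum F (fst z + u, snd z + v)) UNIV"
    by (subst (asm) has_sum_swap) (simp add: z_eq)
qed

section \<open>Dominant homogeneous parts\<close>

text \<open>\<open>\<nu> x\<close> is the central index: the largest maximiser of
  \<open>A j * x ^ j\<close> among \<open>j \<le> n\<close>. For \<open>k > n\<close>,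
  \<open>x < 1\<close> gives \<open>x ^ k \<le> x ^ m\<close>, so \<open>dom\<close> extends the
  maximality to all \<open>k\<close>. Passing from \<open>x\<close> to \<open>y > x\<close>
  multiplies the \<open>j\<close>-th term by \<open>(y / x) ^ j\<close>, which favours large
  \<open>j\<close>; choosing the largest maximiser settles ties and gives monotonicity.\<close>

lemma dominant_term_index:
  fixes A :: "nat \<Rightarrow> real"
  assumes dom: "\<And>k. \<exists>m\<le>n. A k \<le> A m" and A: "\<And>k. 0 \<le> A k"
  obtains \<nu> :: "real \<Rightarrow> nat" where "\<And>x. \<nu> x \<le> n"
    "\<And>x k. 0 < x \<Longrightarrow> x < 1 \<Longrightarrow> A k * x ^ k \<le> A (\<nu> x) * x ^ \<nu> x"
    "\<And>x y. 0 < x \<Longrightarrow> x < y \<Longrightarrow> \<nu> x \<le> \<nu> y"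
proof -
  define S where "S x = {k. k \<le> n \<and> (\<forall>j\<le>n. A j * x ^ j \<le> A k * x ^ k)}" for x
  define \<nu> where "\<nu> x = Max (S x)" for x
  have fin: "finite (S x)" for x
    by (rule finite_subset[of _ "{..n}"]) (auto simp: S_def)
  have "S x \<noteq> {}" for x
  proof -
    let ?I = "(\<lambda>j. A j * x ^ j) ` {..n}"
    have "Max ?I \<in> ?I" by (rule Max_in) auto
    then obtain k where "k \<le> n" "Max ?I = A k * x ^ k" by blast
    then have "k \<in> S x" unfolding S_def by (auto simp flip: \<open>Max ?I = A k * x ^ k\<close>)
    then show ?thesis by blast
  qed
  then have \<nu>: "\<nu> x \<in> S x" for x
    unfolding \<nu>_def using fin by (intro Max_in)
  show ?thesis
  proof
    show "\<nu> x \<le> n" for x using \<nu>[of x] by (simp add: S_def)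
    show "A k * x ^ k \<le> A (\<nu> x) * x ^ \<nu> x" if x: "0 < x" "x < 1" for x k
    proof (cases "k \<le> n")
      case True
      then show ?thesis using \<nu>[of x] by (simp add: S_def)
    next
      case False
      obtain m where m: "m \<le> n" "A k \<le> A m" using dom by blast
      have "A k * x ^ k \<le> A m * x ^ m"
        using m False x A by (intro mult_mono power_decreasing) auto
      also have "\<dots> \<le> A (\<nu> x) * x ^ \<nu> x" using \<nu>[of x] m by (simp add: S_def)
      finally show ?thesis .
    qed
    show "\<nu> x \<le> \<nu> y" if xy: "0 < x" "x < y" for x y
    proof (rule ccontr)
      assume "\<not> \<nu> x \<le> \<nu> y"
      then have less: "\<nu> y < \<nu> x" by simp
      have K: "\<nu> y \<le> n" "\<And>j. j \<le> n \<Longrightarrow> A j * y ^ j \<le> A (\<nu> y) * y ^ \<nu> y"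
        and k: "\<nu> x \<le> n" "A (\<nu> y) * x ^ \<nu> y \<le> A (\<nu> x) * x ^ \<nu> x"
        using \<nu>[of x] \<nu>[of y] by (auto simp: S_def)
      have "A (\<nu> y) * y ^ \<nu> y = A (\<nu> y) * x ^ \<nu> y * (y / x) ^ \<nu> y"
        using xy by (simp add: power_divide)
      also have "\<dots> \<le> A (\<nu> y) * x ^ \<nu> y * (y / x) ^ \<nu> x"
        using xy less A by (intro mult_left_mono power_increasing) auto
      also have "\<dots> \<le> A (\<nu> x) * x ^ \<nu> x * (y / x) ^ \<nu> x"
        using xy k by (intro mult_right_mono) auto
      also have "\<dots> = A (\<nu> x) * y ^ \<nu> x"
        using xy by (simp add: power_divide)
      finally have "\<nu> x \<in> S y"
        using K k by (auto simp: S_def intro: order_trans)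
      then have "\<nu> x \<le> \<nu> y"
        unfolding \<nu>_def[of y] using fin by (intro Max_ge)
      then show False using less by simp
    qed
  qed
qed

text \<open>\<open>(k - k0) + (k0 - k)\<close> is \<open>|k - k0|\<close>, written with truncated subtraction.
  The index of the dominant term is monotone in the radius and takes at most \<open>n + 1\<close> values, so it
  agrees at two consecutive radii of a geometric progression; between those two radii the
  dominance is geometric on both sides.\<close>
lemma geometrically_dominant_radius:
  fixes A :: "nat \<Rightarrow> real"
  assumes dom: "\<And>k. \<exists>m\<le>n. A k \<le> A m" and A: "\<And>k. 0 \<le> A k"
    and \<delta>: "0 < \<delta>" "\<delta> < 1" and s: "0 < s" "s < 1"
  obtains r k0 where "\<delta> * s ^ (2 * n + 2) < r" "r \<le> \<delta>" "k0 \<le> n"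
    "\<And>k. A k * r ^ k \<le> A k0 * r ^ k0 * s ^ ((k - k0) + (k0 - k))"
proof -
  obtain \<nu> :: "real \<Rightarrow> nat" where \<nu>: "\<And>x. \<nu> x \<le> n"
    "\<And>x k. 0 < x \<Longrightarrow> x < 1 \<Longrightarrow> A k * x ^ k \<le> A (\<nu> x) * x ^ \<nu> x"
    "\<And>x y. 0 < x \<Longrightarrow> x < y \<Longrightarrow> \<nu> x \<le> \<nu> y"
    using dominant_term_index[OF dom A] by metis
  \<comment> \<open>The ratio of consecutive radii is \<open>s ^ 2\<close>, so that their geometric
    mean is a factor \<open>s\<close> away from each.\<close>
  define \<rho> where "\<rho> m = \<delta> * s ^ (2 * m)" for m
  have \<rho>: "0 < \<rho> m" "\<rho> m < 1" "\<rho> (Suc m) < \<rho> m" for m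
  proof -
    show "0 < \<rho> m" using \<delta> s by (simp add: \<rho>_def)
    have "s ^ (2 * m) \<le> 1" using s by (intro power_le_one) auto
    then have "\<rho> m \<le> \<delta> * 1" unfolding \<rho>_def using \<delta> by (intro mult_left_mono) auto
    then show "\<rho> m < 1" using \<delta> by simp
    show "\<rho> (Suc m) < \<rho> m"
      unfolding \<rho>_def using \<delta> s by (intro mult_strict_left_mono power_strict_decreasing) auto
  qed
  have "\<exists>m\<le>n. \<nu> (\<rho> m) = \<nu> (\<rho> (Suc m))"
  proof (rule ccontr)
    assume "\<not> ?thesis"
    then have "\<nu> (\<rho> (Suc m)) < \<nu> (\<rho> m)" if "m \<le> n" for m
      using \<nu>(3)[OF \<rho>(1,3), of m] that by (metis le_neq_implies_less)
    \<comment> \<open>Strict decrease at each of \<open>m = 0, ..., n\<close> would lower a natural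
      number that starts at most at \<open>n\<close> by \<open>n + 1\<close>.\<close>
    then have "m \<le> Suc n \<Longrightarrow> \<nu> (\<rho> m) + m \<le> \<nu> (\<rho> 0)" for m
      by (induction m) (force simp: Suc_le_eq)+
    from this[of "Suc n"] \<nu>(1)[of "\<rho> 0"] show False by simp
  qed
  then obtain m where m: "m \<le> n" "\<nu> (\<rho> m) = \<nu> (\<rho> (Suc m))" by blast
  \<comment> \<open>The geometric mean of \<open>\<rho> m\<close> and \<open>\<rho> (Suc m)\<close>.
    Dominance of \<open>k0\<close> at the larger radius gives the decay for
    \<open>k \<ge> k0\<close>, dominance at the smaller one the decay for
    \<open>k < k0\<close>.\<close>
  define r where "r = \<delta> * s ^ (2 * m + 1)"
  define k0 where "k0 = \<nu> (\<rho> m)"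
  have r: "0 < r" "r = \<rho> m * s" "\<rho> (Suc m) = r * s"
    using \<delta> s by (auto simp: r_def \<rho>_def)
  show ?thesis
  proof
    show "\<delta> * s ^ (2 * n + 2) < r"
      unfolding r_def using \<delta> s m by (intro mult_strict_left_mono power_strict_decreasing) auto
    have "r \<le> \<delta> * 1"
      unfolding r_def using \<delta> s by (intro mult_left_mono power_le_one) auto
    then show "r \<le> \<delta>" by simp
    show "k0 \<le> n" using \<nu>(1) by (simp add: k0_def)
    show "A k * r ^ k \<le> A k0 * r ^ k0 * s ^ ((k - k0) + (k0 - k))" for k
    proof (cases "k0 \<le> k")
      case True
      have "A k * r ^ k = A k * \<rho> m ^ k * s ^ k" by (simp add: r(2) power_mult_distrib)
      also have "\<dots> \<le> A k0 * \<rho> m ^ k0 * s ^ k"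
        unfolding k0_def using s by (intro mult_right_mono \<nu>(2) \<rho>) auto
      also have "\<dots> = A k0 * \<rho> m ^ k0 * (s ^ k0 * s ^ (k - k0))"
        using True by (simp flip: power_add)
      also have "\<dots> = A k0 * r ^ k0 * s ^ ((k - k0) + (k0 - k))"
        using True by (simp add: r(2) power_mult_distrib)
      finally show ?thesis .
    next
      case False
      have "A k * r ^ k * s ^ k \<le> A k0 * r ^ k0 * s ^ k0"
        using \<nu>(2)[OF \<rho>(1,2), of k "Suc m"] m(2)
        by (simp add: k0_def r(3) power_mult_distrib mult.assoc)
      also have "\<dots> = A k0 * r ^ k0 * s ^ (k0 - k) * s ^ k"
        using False by (simp add: mult.assoc flip: power_add)
      finally show ?thesis using s False by simp
    qed
  qed
qed

text \<open>The terms above \<open>k0\<close> form the whole series \<open>x + x ^ 2 + ...\<close>;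
  those below form an initial segment of it in reverse order.\<close>

lemma two_sided_geometric_sum_le:
  fixes x :: real
  assumes x: "0 \<le> x" "x < 1"
  obtains S where "(\<lambda>k. if k = k0 then 0 else x ^ ((k - k0) + (k0 - k))) sums S" "S \<le> 2 * (x / (1 - x))"
proof -
  let ?g = "\<lambda>k. if k = k0 then 0 else x ^ ((k - k0) + (k0 - k))"
  have geo: "(\<lambda>i. x * x ^ i) sums (x * (1 / (1 - x)))"
    using x by (intro sums_mult geometric_sums) auto
  then have "(\<lambda>i. ?g (Suc i + k0)) sums (x / (1 - x))" by simp
  then have "(\<lambda>i. ?g (i + k0)) sums (x / (1 - x))"
    using sums_Suc_iff[of "\<lambda>i. ?g (i + k0)"] by simp
  then have "?g sums (x / (1 - x) + (\<Sum>i<k0. ?g i))"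
    by (subst (asm) sums_iff_shift)
  moreover have "(\<Sum>i<k0. ?g i) \<le> x / (1 - x)"
  proof -
    have "(\<Sum>i<k0. ?g i) = (\<Sum>i<k0. x * x ^ (k0 - Suc i))"
      by (rule sum.cong) (auto simp flip: power_Suc simp: Suc_diff_Suc)
    also have "\<dots> = (\<Sum>i<k0. x * x ^ i)"
      by (rule sum.nat_diff_reindex)
    also have "\<dots> \<le> (\<Sum>i. x * x ^ i)"
      using geo x by (intro sum_le_suminf) (auto simp: sums_iff)
    also have "\<dots> = x / (1 - x)" using geo by (simp add: sums_iff)
    finally show ?thesis .
  qed
  ultimately show ?thesis using that by fastforce
qed

lemma norm_diag_poly_le:
  assumes "\<And>j. j \<le> k \<Longrightarrow> norm (tcoeff F z j (k - j)) * norm (fst w) ^ j * norm (snd w) ^ (k - j) \<le> T"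
  shows "norm (diag_poly F z k w) \<le> real (Suc k) * T"
proof -
  have "norm (diag_poly F z k w) \<le> (\<Sum>j\<le>k. T)"
    unfolding diag_poly_def by (intro sum_norm_le) (use assms in \<open>auto simp: norm_mult norm_power\<close>)
  then show ?thesis by simp
qed

text \<open>A homogeneous part of degree \<open>k\<close> has \<open>k + 1\<close> terms, each at
  most \<open>T k\<close> on the torus. The geometric decay of \<open>T\<close> absorbs the factor
  \<open>k + 1\<close>, and the small ratio \<open>s\<close> makes the sum over
  \<open>k \<noteq> k0\<close> at most half of \<open>T k0\<close>.\<close>

lemma main_polynomialI_geometric:
  fixes F z R1 R2
  defines "T \<equiv> \<lambda>k. Max ((\<lambda>j. norm (tcoeff F z j (k - j)) * R1 ^ j * R2 ^ (k - j)) ` {..k})"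
  assumes "k0 \<le> n" and s: "s = 1 / (16 * (real n + 1))"
    and le: "\<And>k. T k \<le> T k0 * s ^ ((k - k0) + (k0 - k))"
    and R: "0 \<le> R1" "0 \<le> R2"
  shows "main_polynomial F z (R1, R2) k0"
  unfolding main_polynomial_def
proof
  fix y assume "y \<in> torus2 z (R1, R2)"
  then have y: "norm (fst y - fst z) = R1" "norm (snd y - snd z) = R2"
    by (auto simp: torus2_def)
  let ?w = "(fst y - fst z, snd y - snd z)"
  \<comment> \<open>The factor 2 pays for \<open>2 ^ ?i\<close> below. Since
    \<open>x \<le> 1 / 2\<close>, the sum is at most \<open>4 * x\<close> times
    \<open>(n + 1) * T k0\<close>, and \<open>4 * x * (n + 1) = 1 / 2\<close> is the reason for the
    16 in \<open>s\<close>.\<close>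
  define x where "x = 2 * s"
  have x: "0 \<le> x" "x < 1" "x \<le> 1 / 2" unfolding x_def s by (auto simp: field_simps)
  have x4: "(real n + 1) * (2 * (x / (1 - x))) \<le> 1 / 2"
  proof -
    have "x / (1 - x) \<le> 2 * x"
      using x by (simp add: field_simps mult_left_le)
    then have "(real n + 1) * (2 * (x / (1 - x))) \<le> (real n + 1) * (2 * (2 * x))"
      by (intro mult_left_mono) auto
    also have "\<dots> = 1 / 2" unfolding x_def s by (simp add: field_simps)
    finally show ?thesis .
  qed
  have T0: "0 \<le> T k0"
  proof -
    have "0 \<le> norm (tcoeff F z 0 (k0 - 0)) * R1 ^ 0 * R2 ^ (k0 - 0)" using R by simp
    also have "\<dots> \<le> T k0" unfolding T_def by (intro Max_ge finite_imageI imageI) auto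
    finally show ?thesis .
  qed
  obtain S where S: "(\<lambda>k. if k = k0 then 0 else x ^ ((k - k0) + (k0 - k))) sums S" "S \<le> 2 * (x / (1 - x))"
    using two_sided_geometric_sum_le[OF x(1,2)] by metis
  let ?f = "\<lambda>k. if k = k0 then 0 else diag_poly F z k ?w"
  let ?g = "\<lambda>k. (T k0 * (real n + 1)) * (if k = k0 then 0 else x ^ ((k - k0) + (k0 - k)))"
  have g: "?g sums (T k0 * (real n + 1) * S)" using S(1) by (rule sums_mult)
  have fg: "norm (?f k) \<le> ?g k" for k
  proof (cases "k = k0")
    case False
    let ?i = "(k - k0) + (k0 - k)"
    have "norm (diag_poly F z k ?w) \<le> real (Suc k) * T k"
      by (intro norm_diag_poly_le) (auto simp: y T_def intro!: Max_ge)
    also have "\<dots> \<le> real (Suc k) * (T k0 * s ^ ?i)"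
      by (intro mult_left_mono le) auto
    \<comment> \<open>From \<open>k \<le> k0 + ?i \<le> n + ?i\<close> follows
      \<open>k + 1 \<le> (n + 1) * (?i + 1)\<close>, and \<open>?i + 1 \<le> 2 ^ ?i\<close>.\<close>
    also have "real (Suc k) \<le> (real n + 1) * 2 ^ ?i"
    proof -
      have "Suc k \<le> (n + 1) * (?i + 1)" using \<open>k0 \<le> n\<close> by simp
      also have "\<dots> \<le> (n + 1) * 2 ^ ?i"
        by (intro mult_le_mono2) (use less_exp[of ?i] in linarith)
      finally have "real (Suc k) \<le> real ((n + 1) * 2 ^ ?i)" by (simp only: of_nat_le_iff)
      then show ?thesis by (simp add: algebra_simps)
    qed
    then have "real (Suc k) * (T k0 * s ^ ?i) \<le> (real n + 1) * 2 ^ ?i * (T k0 * s ^ ?i)"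
      using T0 s by (intro mult_right_mono) auto
    also have "\<dots> = ?g k" using False by (simp add: x_def power_mult_distrib mult_ac)
    finally show ?thesis using False by simp
  qed simp
  have "norm (suminf ?f) \<le> suminf ?g"
    using fg g by (intro norm_suminf_le) (auto simp: sums_iff)
  also have "\<dots> = T k0 * ((real n + 1) * S)"
    using g by (simp add: sums_iff)
  also have "\<dots> \<le> T k0 * (1 / 2)"
  proof (intro mult_left_mono T0)
    have "(real n + 1) * S \<le> (real n + 1) * (2 * (x / (1 - x)))"
      using S(2) by (intro mult_left_mono) auto
    with x4 show "(real n + 1) * S \<le> 1 / 2" by linarith
  qed
  finally show "norm (\<Sum>k. if k = k0 then 0 else diag_poly F z k ?w)
      \<le> 1 / 2 * Max ((\<lambda>j1. norm (tcoeff F z j1 (k0 - j1)) * fst (R1, R2) ^ j1 * snd (R1, R2) ^ (k0 - j1)) ` {..k0})"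
    by (simp add: T_def)
qed

section \<open>Scaled Taylor coefficients, and main polynomials from bounded index\<close>

definition scaled_coeff :: "(complex \<times> complex \<Rightarrow> complex) \<Rightarrow> (complex \<times> complex \<Rightarrow> real) \<Rightarrow>
    (complex \<times> complex \<Rightarrow> real) \<Rightarrow> complex \<times> complex \<Rightarrow> nat \<Rightarrow> nat \<Rightarrow> real" where
  "scaled_coeff F l1 l2 z p q = norm (tcoeff F z p q) / (l1 z ^ p * l2 z ^ q)"

text \<open>This is \<open>M(z)\<close> of the opening comment, and also the right-hand side of the
  index inequality with \<open>n0 = n\<close>.\<close>

definition scaled_jet :: "(complex \<times> complex \<Rightarrow> complex) \<Rightarrow> (complex \<times> complex \<Rightarrow> real) \<Rightarrow>
    (complex \<times> complex \<Rightarrow> real) \<Rightarrow> nat \<Rightarrow> complex \<times> complex \<Rightarrow> real" where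
  "scaled_jet F l1 l2 n z = Max ((\<lambda>(p, q). scaled_coeff F l1 l2 z p q) ` {(p, q). p + q \<le> n})"

lemma finite_nat_simplex: "finite {(p, q). p + q \<le> (n::nat)}"
  by (rule finite_subset[of _ "{..n} \<times> {..n}"]) auto

lemma scaled_coeff_le_jet: "p + q \<le> n \<Longrightarrow> scaled_coeff F l1 l2 z p q \<le> scaled_jet F l1 l2 n z"
  unfolding scaled_jet_def by (intro Max_ge finite_imageI finite_nat_simplex) auto

lemma scaled_jet_le_iff:
  "scaled_jet F l1 l2 n z \<le> B \<longleftrightarrow> (\<forall>p q. p + q \<le> n \<longrightarrow> scaled_coeff F l1 l2 z p q \<le> B)"
  unfolding scaled_jet_def by (subst Max_le_iff) (use finite_nat_simplex[of n] in \<open>auto intro!: exI[of _ 0]\<close>)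

lemma scaled_jet_attained:
  obtains p q where "p + q \<le> n" "scaled_jet F l1 l2 n z = scaled_coeff F l1 l2 z p q"
proof -
  have "scaled_jet F l1 l2 n z \<in> (\<lambda>(p, q). scaled_coeff F l1 l2 z p q) ` {(p, q). p + q \<le> n}"
    unfolding scaled_jet_def
    by (rule Max_in) (auto intro!: finite_imageI finite_nat_simplex exI[of _ 0])
  then show ?thesis using that by auto
qed

lemma bounded_L_index_joint_iff:
  "bounded_L_index_joint F l1 l2 \<longleftrightarrow>
    (\<exists>n. \<forall>z\<in>bidisc. \<forall>p q. scaled_coeff F l1 l2 z p q \<le> scaled_jet F l1 l2 n z)"
proof -
  have "norm (pderiv2 F p q z) / (fact p * fact q * l1 z ^ p * l2 z ^ q) = scaled_coeff F l1 l2 z p q"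
    for p q z
    by (simp add: scaled_coeff_def tcoeff_def norm_divide norm_mult mult_ac)
  then show ?thesis
    by (simp add: bounded_L_index_joint_def scaled_jet_def)
qed

text \<open>The largest scaled coefficients of each degree form a sequence \<open>A\<close> to which
  \<open>geometrically_dominant_radius\<close> applies, with the ratio \<open>s\<close> demanded by
  \<open>main_polynomialI_geometric\<close>. The resulting \<open>\<eta>\<close> depends on
  \<open>n\<close> and \<open>d\<close> but not on \<open>z\<close>.\<close>

lemma bounded_index_imp_main_polynomial:
  assumes l: "\<And>z. z \<in> bidisc \<Longrightarrow> 0 < l1 z" "\<And>z. z \<in> bidisc \<Longrightarrow> 0 < l2 z"
    and bi: "\<And>z p q. z \<in> bidisc \<Longrightarrow> scaled_coeff F l1 l2 z p q \<le> scaled_jet F l1 l2 n z"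
    and d: "0 < d"
  obtains \<eta> where "0 < \<eta>" "\<eta> < d"
    "\<And>z. z \<in> bidisc \<Longrightarrow> \<exists>r k0. \<eta> < r \<and> r < d \<and> k0 \<le> n \<and> main_polynomial F z (r / l1 z, r / l2 z) k0"
proof -
  \<comment> \<open>Below 1 so that powers of the radius decrease; strictly below \<open>d\<close>
    because the radius found satisfies \<open>r \<le> \<delta>\<close> and must satisfy
    \<open>r < d\<close>.\<close>
  define \<delta> where "\<delta> = min d 1 / 2"
  have \<delta>: "0 < \<delta>" "\<delta> < 1" "\<delta> < d" using d by (auto simp: \<delta>_def min_def)
  define s where "s = 1 / (16 * (real n + 1))"
  have s: "0 < s" "s < 1" by (auto simp: s_def field_simps)
  show ?thesis
  proof
    show "0 < \<delta> * s ^ (2 * n + 2)" using \<delta> s by simp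
    have "\<delta> * s ^ (2 * n + 2) \<le> \<delta> * 1"
      using \<delta> s by (intro mult_left_mono power_le_one) auto
    then show "\<delta> * s ^ (2 * n + 2) < d" using \<delta>(3) by linarith
    fix z assume z: "z \<in> bidisc"
    define A where "A k = Max ((\<lambda>j. scaled_coeff F l1 l2 z j (k - j)) ` {..k})" for k
    have sc0: "0 \<le> scaled_coeff F l1 l2 z p q" for p q
      using l[OF z] by (simp add: scaled_coeff_def)
    have A_ge: "scaled_coeff F l1 l2 z p q \<le> A (p + q)" for p q
      unfolding A_def by (intro Max_ge) (auto simp: image_iff intro!: bexI[of _ p])
    have A0: "0 \<le> A k" for k using A_ge[of 0 k] sc0[of 0 k] by simp
    \<comment> \<open>The jet maximum is attained at some \<open>(p, q)\<close>, and the degree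
      \<open>p + q\<close> serves as \<open>m\<close>.\<close>
    have "\<exists>m\<le>n. A k \<le> A m" for k
    proof -
      obtain p q where pq: "p + q \<le> n" "scaled_jet F l1 l2 n z = scaled_coeff F l1 l2 z p q"
        by (rule scaled_jet_attained)
      have "A k \<le> scaled_jet F l1 l2 n z"
        unfolding A_def using bi[OF z] by (subst Max_le_iff) auto
      also have "\<dots> \<le> A (p + q)" using pq A_ge by simp
      finally show ?thesis using pq(1) by blast
    qed
    then obtain r k0 where r: "\<delta> * s ^ (2 * n + 2) < r" "r \<le> \<delta>" "k0 \<le> n"
      "\<And>k. A k * r ^ k \<le> A k0 * r ^ k0 * s ^ ((k - k0) + (k0 - k))"
      using geometrically_dominant_radius[of n A \<delta> s] A0 \<delta> s by metis
    have "0 < r" using r(1) \<open>0 < \<delta> * s ^ (2 * n + 2)\<close> by linarith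
    have T: "Max ((\<lambda>j. norm (tcoeff F z j (k - j)) * (r / l1 z) ^ j * (r / l2 z) ^ (k - j)) ` {..k}) = A k * r ^ k" for k
    proof -
      have "(\<lambda>j. norm (tcoeff F z j (k - j)) * (r / l1 z) ^ j * (r / l2 z) ^ (k - j)) ` {..k}
          = (\<lambda>x. x * r ^ k) ` ((\<lambda>j. scaled_coeff F l1 l2 z j (k - j)) ` {..k})"
        unfolding image_image
      proof (rule image_cong[OF refl])
        fix j assume "j \<in> {..k}"
        then have "r ^ k = r ^ j * r ^ (k - j)" by (simp flip: power_add)
        then show "norm (tcoeff F z j (k - j)) * (r / l1 z) ^ j * (r / l2 z) ^ (k - j)
            = scaled_coeff F l1 l2 z j (k - j) * r ^ k"
          by (simp add: scaled_coeff_def power_divide)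
      qed
      moreover have "mono (\<lambda>x. x * r ^ k)"
        using \<open>0 < r\<close> by (intro monoI mult_right_mono) auto
      ultimately show ?thesis
        unfolding A_def by (subst mono_Max_commute[of "\<lambda>x. x * r ^ k"]) auto
    qed
    have "main_polynomial F z (r / l1 z, r / l2 z) k0"
      by (rule main_polynomialI_geometric[OF r(3) s_def])
         (use r(4) l[OF z] \<open>0 < r\<close> in \<open>auto simp: T\<close>)
    then show "\<exists>r k0. \<delta> * s ^ (2 * n + 2) < r \<and> r < d \<and> k0 \<le> n \<and> main_polynomial F z (r / l1 z, r / l2 z) k0"
      using r(1-3) \<delta>(3) by (intro exI[of _ r] exI[of _ k0]) auto
  qed
qed

section \<open>From main polynomials to bounded index\<close>

lemma tcoeff_Cauchy_inequality:
  assumes F: "analytic2 F bidisc" and z: "z \<in> bidisc"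
    and R: "0 < R1" "R1 < 1 - norm (fst z)" "0 < R2" "R2 < 1 - norm (snd z)"
    and B: "\<And>w. w \<in> torus2 z (R1, R2) \<Longrightarrow> norm (F w) \<le> B"
  shows "norm (tcoeff F z p q) * R1 ^ p * R2 ^ q \<le> B"
proof (rule double_power_series_Cauchy_inequality)
  show "(\<lambda>(p, q). norm (tcoeff F z p q) * R1 ^ p * R2 ^ q) summable_on UNIV"
    using tcoeff_abs_summable_and_sum(1)[OF F z, of "of_real R1" "of_real R2"] R by simp
next
  fix u v :: complex assume uv: "norm u = R1" "norm v = R2"
  have "((\<lambda>(p, q). tcoeff F z p q * u ^ p * v ^ q) has_sum F (fst z + u, snd z + v)) UNIV"
    using tcoeff_abs_summable_and_sum(2)[OF F z, of u v] R uv by simp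
  then have "infsum (\<lambda>(p, q). tcoeff F z p q * u ^ p * v ^ q) UNIV = F (fst z + u, snd z + v)"
    by (rule infsumI)
  then show "norm (infsum (\<lambda>(p, q). tcoeff F z p q * u ^ p * v ^ q) UNIV) \<le> B"
    using uv by (auto simp: torus2_def intro!: B)
qed (use R in auto)

text \<open>The sum without \<open>p_{k0}\<close> is the double series with all coefficients of
  degree \<open>k0\<close> set to zero. The main polynomial condition bounds it by
  \<open>T / 2\<close> on the torus, so Cauchy's inequalities bound every remaining coefficient;
  those of degree \<open>k0\<close> are bounded by the definition of \<open>T\<close>.\<close>

lemma main_polynomial_dominates:
  fixes F z R1 R2 k0
  defines "T \<equiv> Max ((\<lambda>j. norm (tcoeff F z j (k0 - j)) * R1 ^ j * R2 ^ (k0 - j)) ` {..k0})"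
  assumes F: "analytic2 F bidisc" and z: "z \<in> bidisc"
    and R: "0 < R1" "R1 < 1 - norm (fst z)" "0 < R2" "R2 < 1 - norm (snd z)"
    and mp: "main_polynomial F z (R1, R2) k0"
  shows "norm (tcoeff F z p q) * R1 ^ p * R2 ^ q \<le> T"
proof (cases "p + q = k0")
  case True
  then show ?thesis
    unfolding T_def by (intro Max_ge) (auto simp: image_iff intro!: bexI[of _ p])
next
  case False
  define a where "a p q = (if p + q = k0 then 0 else tcoeff F z p q)" for p q
  have sm: "(\<lambda>(p, q). norm (a p q) * R1 ^ p * R2 ^ q) summable_on UNIV"
  proof (rule summable_on_comparison_test)
    show "(\<lambda>(p, q). norm (tcoeff F z p q) * R1 ^ p * R2 ^ q) summable_on UNIV"
      using tcoeff_abs_summable_and_sum(1)[OF F z, of "of_real R1" "of_real R2"] R by simp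
  qed (use R in \<open>auto simp: a_def\<close>)
  have "norm (a p q) * R1 ^ p * R2 ^ q \<le> T / 2"
  proof (rule double_power_series_Cauchy_inequality[OF sm R(1,3)])
    fix u v :: complex assume uv: "norm u = R1" "norm v = R2"
    let ?f = "\<lambda>(p, q). a p q * u ^ p * v ^ q"
    have "(\<lambda>x. norm (?f x)) summable_on UNIV"
      using sm uv by (simp add: case_prod_unfold norm_mult norm_power)
    then have "?f summable_on UNIV" by (rule abs_summable_summable)
    then have "(\<lambda>k. \<Sum>j\<le>k. ?f (j, k - j)) sums infsum ?f UNIV"
      by (intro sums_diagonals has_sum_infsum)
    moreover have "(\<Sum>j\<le>k. ?f (j, k - j)) = (if k = k0 then 0 else diag_poly F z k (u, v))" for k
      by (simp add: a_def diag_poly_def)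
    ultimately have "infsum ?f UNIV = (\<Sum>k. if k = k0 then 0 else diag_poly F z k (u, v))"
      by (simp add: sums_iff)
    moreover have "(fst z + u, snd z + v) \<in> torus2 z (R1, R2)"
      using uv by (simp add: torus2_def)
    ultimately show "norm (infsum ?f UNIV) \<le> T / 2"
      using bspec[OF mp[unfolded main_polynomial_def], of "(fst z + u, snd z + v)"]
      by (simp add: T_def cong: if_cong)
  qed
  moreover have "0 \<le> T / 2"
  proof -
    have "0 \<le> norm (tcoeff F z 0 (k0 - 0)) * R1 ^ 0 * R2 ^ (k0 - 0)" using R by simp
    also have "\<dots> \<le> T" unfolding T_def by (intro Max_ge finite_imageI imageI) auto
    finally show ?thesis by simp
  qed
  ultimately show ?thesis using False by (simp add: a_def)
qed

text \<open>Shrinking both radii by \<open>2 / 3\<close> leaves a product of two geometric series of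
  ratio \<open>2 / 3\<close>, each with sum 3.\<close>

lemma norm_le_of_scaled_tcoeff_le:
  assumes F: "analytic2 F bidisc" and z: "z \<in> bidisc"
    and R: "0 < R1" "R1 < 1 - norm (fst z)" "0 < R2" "R2 < 1 - norm (snd z)"
    and T: "\<And>p q. norm (tcoeff F z p q) * R1 ^ p * R2 ^ q \<le> T"
    and w: "w \<in> cpolydisc z (2 / 3 * R1, 2 / 3 * R2)"
  shows "norm (F w) \<le> 9 * T"
proof -
  define u v where "u = fst w - fst z" and "v = snd w - snd z"
  have uv: "norm u \<le> 2 / 3 * R1" "norm v \<le> 2 / 3 * R2" "w = (fst z + u, snd z + v)"
    using w by (auto simp: u_def v_def cpolydisc_def)
  have "((\<lambda>(p, q). tcoeff F z p q * u ^ p * v ^ q) has_sum F w) UNIV"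
    using tcoeff_abs_summable_and_sum(2)[OF F z, of u v] R uv by simp
  moreover have "((\<lambda>x. T * (case x of (p, q) \<Rightarrow> (2 / 3) ^ p * (2 / 3) ^ q)) has_sum
      (T * (1 / (1 - 2 / 3) * (1 / (1 - 2 / 3))))) UNIV"
    by (intro has_sum_cmult_right has_sum_geometric_product) auto
  moreover have "norm (case x of (p, q) \<Rightarrow> tcoeff F z p q * u ^ p * v ^ q)
      \<le> T * (case x of (p, q) \<Rightarrow> (2 / 3) ^ p * (2 / 3) ^ q)" for x
  proof -
    obtain p q where x: "x = (p, q)" by (cases x)
    have "norm (tcoeff F z p q * u ^ p * v ^ q) = norm (tcoeff F z p q) * (norm u ^ p * norm v ^ q)"
      by (simp add: norm_mult norm_power)
    also have "\<dots> \<le> norm (tcoeff F z p q) * ((2 / 3 * R1) ^ p * (2 / 3 * R2) ^ q)"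
      using R uv by (intro mult_left_mono mult_mono power_mono) auto
    also have "\<dots> = (norm (tcoeff F z p q) * R1 ^ p * R2 ^ q) * ((2 / 3) ^ p * (2 / 3) ^ q)"
      by (simp only: power_mult_distrib mult_ac)
    also have "\<dots> \<le> T * ((2 / 3) ^ p * (2 / 3) ^ q)"
      by (intro mult_right_mono T) auto
    finally show ?thesis by (simp add: x)
  qed
  ultimately have "norm (F w) \<le> T * (1 / (1 - 2 / 3) * (1 / (1 - 2 / 3)))"
    by (rule norm_infsum_le)
  then show ?thesis by simp
qed

lemma scaled_coeff_conv_tcoeff:
  assumes "0 < l1 z" "0 < l2 z"
  shows "norm (tcoeff F z p q) * (r / l1 z) ^ p * (r / l2 z) ^ q = scaled_coeff F l1 l2 z p q * r ^ (p + q)"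
  by (simp add: scaled_coeff_def power_divide power_add)

text \<open>As \<open>r \<le> 1\<close>, the factor \<open>r ^ k0\<close> only decreases the scaled
  coefficients of degree \<open>k0 \<le> n\<close>, so the dominating maximum is at most the
  jet.\<close>

lemma main_polynomial_imp_bound:
  assumes F: "analytic2 F bidisc" and z: "z \<in> bidisc" and l: "0 < l1 z" "0 < l2 z"
    and r: "0 < r" "r \<le> 1" "r / l1 z < 1 - norm (fst z)" "r / l2 z < 1 - norm (snd z)"
    and mp: "main_polynomial F z (r / l1 z, r / l2 z) k0" and "k0 \<le> n"
    and w: "w \<in> cpolydisc z (2 / 3 * (r / l1 z), 2 / 3 * (r / l2 z))"
  shows "norm (F w) \<le> 9 * scaled_jet F l1 l2 n z"
proof (rule norm_le_of_scaled_tcoeff_le[OF F z _ r(3) _ r(4) _ w])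
  fix p q
  let ?T = "Max ((\<lambda>j. norm (tcoeff F z j (k0 - j)) * (r / l1 z) ^ j * (r / l2 z) ^ (k0 - j)) ` {..k0})"
  have "norm (tcoeff F z p q) * (r / l1 z) ^ p * (r / l2 z) ^ q \<le> ?T"
    using l r by (intro main_polynomial_dominates[OF F z _ r(3) _ r(4) mp]) auto
  also have "?T \<le> scaled_jet F l1 l2 n z"
  proof (subst Max_le_iff; clarsimp simp: scaled_coeff_conv_tcoeff[of l1 z l2, OF l])
    fix j assume "j \<le> k0"
    have "scaled_coeff F l1 l2 z j (k0 - j) * r ^ k0 \<le> scaled_coeff F l1 l2 z j (k0 - j) * 1"
      using r l by (intro mult_left_mono power_le_one) (auto simp: scaled_coeff_def)
    also have "\<dots> \<le> scaled_jet F l1 l2 n z"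
      using \<open>j \<le> k0\<close> \<open>k0 \<le> n\<close> by (simp add: scaled_coeff_le_jet)
    finally show "scaled_coeff F l1 l2 z j (k0 - j) * r ^ k0 \<le> scaled_jet F l1 l2 n z" .
  qed
  finally show "norm (tcoeff F z p q) * (r / l1 z) ^ p * (r / l2 z) ^ q \<le> scaled_jet F l1 l2 n z" .
qed (use l r in auto)

text \<open>Turns the extended-real infimum and supremum at \<open>R = (\<beta>, \<beta>)\<close>
  into positive real constants, uniform in the centre and common to both weights.\<close>

lemma Q2_bounds:
  assumes Q: "Q2 \<beta> l1 l2" and "0 \<le> \<beta>"
  obtains c C :: real where "0 < c" "0 < C"
    "\<And>z0 z l. z0 \<in> bidisc \<Longrightarrow> z \<in> cpolydisc z0 (\<beta> / l1 z0, \<beta> / l2 z0) \<Longrightarrow> l \<in> {l1, l2} \<Longrightarrow>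
      c \<le> l z / l z0 \<and> l z / l z0 \<le> C"
proof -
  have "\<exists>c C. 0 < c \<and> 0 < C \<and> (\<forall>z0\<in>bidisc. \<forall>z\<in>cpolydisc z0 (\<beta> / l1 z0, \<beta> / l2 z0).
      c \<le> l z / l z0 \<and> l z / l z0 \<le> C)" if l: "l \<in> {l1, l2}" for l
  proof -
    let ?m = "lambda1 l l1 l2 (\<beta>, \<beta>)" and ?M = "lambda2 l l1 l2 (\<beta>, \<beta>)"
    have *: "0 < ?m" "?M < \<infinity>" using Q l \<open>0 \<le> \<beta>\<close> unfolding Q2_def by auto
    obtain c where c: "0 < ereal c" "ereal c < ?m"
      using ereal_dense2[OF *(1)] by auto
    obtain C where C: "max 0 ?M < ereal C"
    proof -
      have "max 0 ?M < \<infinity>" using *(2) by (simp add: max_def del: ereal_infty_less)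
      then show ?thesis using that ereal_dense2 by blast
    qed
    have bds: "?m \<le> ereal (l z / l z0)" "ereal (l z / l z0) \<le> ?M"
      if "z0 \<in> bidisc" "z \<in> cpolydisc z0 (\<beta> / l1 z0, \<beta> / l2 z0)" for z0 z
      unfolding lambda1_def lambda2_def using that
      by (auto intro!: INF_lower2[of z0] SUP_upper2[of z0] INF_lower SUP_upper)
    have "c \<le> l z / l z0 \<and> l z / l z0 \<le> C"
      if "z0 \<in> bidisc" "z \<in> cpolydisc z0 (\<beta> / l1 z0, \<beta> / l2 z0)" for z0 z
    proof -
      have "ereal c \<le> ereal (l z / l z0)" using bds(1)[OF that] c(2) by order
      moreover have "ereal (l z / l z0) \<le> ereal C" using bds(2)[OF that] C by (meson max.strict_boundedE less_imp_le order_trans)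
      ultimately show ?thesis by simp
    qed
    moreover have "0 < C" using C by (simp add: zero_ereal_def)
    ultimately show ?thesis using c(1) by (intro exI[of _ c] exI[of _ C]) (auto simp: zero_ereal_def)
  qed
  from this[of l1] this[of l2] obtain c1 C1 c2 C2 where
    "0 < c1" "0 < C1" "0 < c2" "0 < C2"
    "\<forall>z0\<in>bidisc. \<forall>z\<in>cpolydisc z0 (\<beta> / l1 z0, \<beta> / l2 z0). c1 \<le> l1 z / l1 z0 \<and> l1 z / l1 z0 \<le> C1"
    "\<forall>z0\<in>bidisc. \<forall>z\<in>cpolydisc z0 (\<beta> / l1 z0, \<beta> / l2 z0). c2 \<le> l2 z / l2 z0 \<and> l2 z / l2 z0 \<le> C2"
    by auto
  then show ?thesis
    by (intro that[of "min c1 c2" "max C1 C2"]) (fastforce simp: min_le_iff_disj le_max_iff_disj)+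
qed

lemma norm_le_scaled_jet: "norm (F z) \<le> scaled_jet F l1 l2 n z"
  using scaled_coeff_le_jet[of 0 0 n F l1 l2 z] by (simp add: scaled_coeff_def tcoeff_def pderiv2_def)

lemma scaled_jet_nonneg: "0 \<le> scaled_jet F l1 l2 n z"
  using norm_ge_zero norm_le_scaled_jet order_trans by blast

lemma scaled_jet_mono:
  assumes "m \<le> n"
  shows "scaled_jet F l1 l2 m z \<le> scaled_jet F l1 l2 n z"
  using assms by (auto simp: scaled_jet_le_iff intro!: scaled_coeff_le_jet)

lemma weights_pos:
  assumes "0 < \<beta>" and "\<beta> / (1 - norm (fst z)) < l1 z" and "\<beta> / (1 - norm (snd z)) < l2 z"
    and "z \<in> bidisc"
  shows "0 < l1 z" "0 < l2 z"
proof -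
  have "0 < \<beta> / (1 - norm (fst z))" "0 < \<beta> / (1 - norm (snd z))"
    using assms by (auto simp: bidisc_def)
  then show "0 < l1 z" "0 < l2 z" using assms by linarith+
qed

text \<open>The lower bound \<open>\<eta>\<close> on the radii is what makes the step length, and
  hence the number of steps in the chain, independent of the centre.\<close>

lemma main_polynomial_imp_bounded_index:
  fixes F :: "complex \<times> complex \<Rightarrow> complex" and l1 l2 :: "complex \<times> complex \<Rightarrow> real"
  assumes F: "analytic2 F bidisc" and \<beta>: "1 < \<beta>"
    and l1: "\<And>z. z \<in> bidisc \<Longrightarrow> \<beta> / (1 - norm (fst z)) < l1 z"
    and l2: "\<And>z. z \<in> bidisc \<Longrightarrow> \<beta> / (1 - norm (snd z)) < l2 z"
    and Q: "Q2 \<beta> l1 l2"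
    and \<eta>: "0 < \<eta>" "\<eta> < 1"
    and mp: "\<And>z. z \<in> bidisc \<Longrightarrow> \<exists>r k0. \<eta> < r \<and> r < 1 \<and> k0 \<le> n \<and> main_polynomial F z (r / l1 z, r / l2 z) k0"
  shows "bounded_L_index_joint F l1 l2"
proof -
  let ?J = "scaled_jet F l1 l2 n"
  have pos: "0 < l1 z" "0 < l2 z" if "z \<in> bidisc" for z
    using weights_pos[of \<beta> z l1 l2] l1 l2 \<beta> that by auto
  \<comment> \<open>The growth condition on the weights keeps the closed polydisc of scaled radius
    \<open>\<beta>\<close> inside the bidisc.\<close>
  have room: "\<beta> / l1 z < 1 - norm (fst z)" "\<beta> / l2 z < 1 - norm (snd z)" if "z \<in> bidisc" for z
    using l1[OF that] l2[OF that] pos[OF that] that by (auto simp: bidisc_def field_simps)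
  have sub: "w \<in> bidisc" if z: "z \<in> bidisc" and w: "w \<in> cpolydisc z (\<beta> / l1 z, \<beta> / l2 z)" for z w
    using room[OF z] w norm_triangle_sub[of "fst w" "fst z"] norm_triangle_sub[of "snd w" "snd z"]
    by (auto simp: cpolydisc_def bidisc_def)
  obtain c C where cC: "0 < c" "0 < C"
    "\<And>z0 z l. z0 \<in> bidisc \<Longrightarrow> z \<in> cpolydisc z0 (\<beta> / l1 z0, \<beta> / l2 z0) \<Longrightarrow> l \<in> {l1, l2} \<Longrightarrow>
      c \<le> l z / l z0 \<and> l z / l z0 \<le> C"
  proof -
    have "0 \<le> \<beta>" using \<beta> by simp
    from Q2_bounds[OF Q this] that show ?thesis by blast
  qed
  \<comment> \<open>At the centre the ratio is 1. The bound makes \<open>3 / (\<eta> * c)\<close> at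
    least 1, so that its powers up to \<open>n\<close> are bounded by the
    \<open>n\<close>-th.\<close>
  have c1: "c \<le> 1"
  proof -
    have "(0, 0) \<in> bidisc" by (simp add: bidisc_def)
    then show ?thesis
      using cC(3)[of "(0, 0)" "(0, 0)" l1] pos[of "(0, 0)"] \<beta> by (simp add: cpolydisc_def)
  qed
  \<comment> \<open>The 9 is the loss in bounding \<open>F\<close> by its jet; each of at most
    \<open>n\<close> derivatives costs \<open>3 / \<eta>\<close> for the torus radius and
    \<open>1 / c\<close> for replacing the weight at \<open>w\<close> by that at
    \<open>z\<close>.\<close>
  define K where "K = 9 * (3 / (\<eta> * c)) ^ n"
  have "0 < K" using \<eta> cC by (simp add: K_def)
  \<comment> \<open>The torus of radii \<open>\<eta> / 3\<close> about \<open>w\<close>, scaled by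
    the weights at \<open>z\<close>, lies within scaled distance
    \<open>2 * \<eta> / 3 < 2 * r / 3\<close> of \<open>z\<close>, where \<open>F\<close> is already
    bounded by \<open>9 * ?J z\<close>.\<close>
  have step: "?J w \<le> K * ?J z"
    if z: "z \<in> bidisc" and w: "w \<in> cpolydisc z (\<eta> / 3 / l1 z, \<eta> / 3 / l2 z)" for z w
  proof -
    obtain r k0 where r: "\<eta> < r" "r < 1" "k0 \<le> n" and mp_r: "main_polynomial F z (r / l1 z, r / l2 z) k0"
      using mp[OF z] by blast
    note lz = pos[OF z]
    have le\<beta>: "x / l1 z \<le> \<beta> / l1 z" "x / l2 z \<le> \<beta> / l2 z" if "x \<le> \<beta>" for x
      using that lz by (auto simp: divide_right_mono)
    have w\<beta>: "w \<in> cpolydisc z (\<beta> / l1 z, \<beta> / l2 z)"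
      using w le\<beta>[of "\<eta> / 3"] \<eta> \<beta> by (auto simp: cpolydisc_def)
    have wb: "w \<in> bidisc" by (rule sub[OF z w\<beta>])
    note lw = pos[OF wb]
    have lwz: "c * l1 z \<le> l1 w" "c * l2 z \<le> l2 w"
      using cC(3)[OF z w\<beta>, of l1] cC(3)[OF z w\<beta>, of l2] lz by (auto simp: pos_le_divide_eq)
    let ?R1 = "\<eta> / 3 / l1 z" and ?R2 = "\<eta> / 3 / l2 z"
    have R: "0 < ?R1" "0 < ?R2" using \<eta> lz by auto
    have third: "2 * ?R1 \<le> 2 / 3 * (r / l1 z)" "2 * ?R2 \<le> 2 / 3 * (r / l2 z)"
      using r lz by (auto simp: divide_right_mono)
    have rR: "r / l1 z < 1 - norm (fst z)" "r / l2 z < 1 - norm (snd z)"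
      using le\<beta>[of r] r \<beta> room[OF z] by auto
    have Rw: "?R1 < 1 - norm (fst w)" "?R2 < 1 - norm (snd w)"
    proof -
      have "norm (fst w) \<le> norm (fst z) + ?R1" "norm (snd w) \<le> norm (snd z) + ?R2"
        using w norm_triangle_sub[of "fst w" "fst z"] norm_triangle_sub[of "snd w" "snd z"]
        by (auto simp: cpolydisc_def)
      moreover have "0 < r / l1 z" "0 < r / l2 z" using lz r \<eta> by auto
      ultimately show "?R1 < 1 - norm (fst w)" "?R2 < 1 - norm (snd w)"
        using third rR by linarith+
    qed
    have Fb: "norm (F y) \<le> 9 * ?J z" if y: "y \<in> torus2 w (?R1, ?R2)" for y
    proof (rule main_polynomial_imp_bound[where ?l1.0 = l1 and ?l2.0 = l2, OF F z lz _ _ rR mp_r r(3)])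
      have "norm (fst y - fst z) \<le> 2 * ?R1" "norm (snd y - snd z) \<le> 2 * ?R2"
        using y w norm_triangle_ineq[of "fst y - fst w" "fst w - fst z"]
          norm_triangle_ineq[of "snd y - snd w" "snd w - snd z"]
        by (auto simp: torus2_def cpolydisc_def)
      then show "y \<in> cpolydisc z (2 / 3 * (r / l1 z), 2 / 3 * (r / l2 z))"
        using third by (auto simp: cpolydisc_def)
    qed (use r \<eta> in auto)
    show ?thesis
      unfolding scaled_jet_le_iff
    proof (intro allI impI)
      fix p q assume pq: "p + q \<le> n"
      have "norm (tcoeff F w p q) * ?R1 ^ p * ?R2 ^ q \<le> 9 * ?J z"
        by (rule tcoeff_Cauchy_inequality[OF F wb R(1) Rw(1) R(2) Rw(2) Fb])
      have "scaled_coeff F l1 l2 w p q \<le> norm (tcoeff F w p q) / ((c * l1 z) ^ p * (c * l2 z) ^ q)"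
        unfolding scaled_coeff_def using lz lw lwz cC(1)
        by (intro divide_left_mono mult_mono power_mono mult_pos_pos zero_less_power) auto
      also have "\<dots> = (norm (tcoeff F w p q) * ?R1 ^ p * ?R2 ^ q) * (3 / (\<eta> * c)) ^ (p + q)"
        using \<eta> by (simp add: power_divide power_mult_distrib power_add)
      also have "\<dots> \<le> 9 * ?J z * (3 / (\<eta> * c)) ^ n"
      proof (rule mult_mono)
        have "\<eta> * c \<le> 1" using \<eta> cC c1 by (intro mult_le_one) auto
        then show "(3 / (\<eta> * c)) ^ (p + q) \<le> (3 / (\<eta> * c)) ^ n"
          using pq \<eta> cC by (intro power_increasing) (auto simp: field_simps)
      qed (use \<open>_ \<le> 9 * ?J z\<close> scaled_jet_nonneg \<eta> cC in auto)
      finally show "scaled_coeff F l1 l2 w p q \<le> K * ?J z" by (simp add: K_def mult_ac)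
    qed
  qed
  \<comment> \<open>The segment from \<open>z\<close> to \<open>w\<close> is cut into
    \<open>N\<close> equal pieces. Each has scaled length at most \<open>\<beta> / N\<close> at
    \<open>z\<close>, hence at most \<open>C * \<beta> / N\<close> at the intermediate point, which
    must not exceed \<open>\<eta> / 3\<close>.\<close>
  obtain N :: nat where N: "3 * \<beta> * C / \<eta> < real N" using reals_Archimedean2 by blast
  have N0: "0 < real N"
    using N \<beta> cC \<eta> by (intro less_trans[OF _ N]) auto
  have bound: "norm (F w) \<le> K ^ N * ?J z"
    if z: "z \<in> bidisc" and w: "w \<in> cpolydisc z (\<beta> / l1 z, \<beta> / l2 z)" for z w
  proof -
    define y where "y m = z + (real m / real N) *\<^sub>R (w - z)" for m
    note lz = pos[OF z]
    have y_in: "y m \<in> cpolydisc z (\<beta> / l1 z, \<beta> / l2 z)" if "m \<le> N" for m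
    proof -
      have t: "0 \<le> real m / real N" "real m / real N \<le> 1" using that N0 by auto
      have "real m / real N * norm (fst w - fst z) \<le> 1 * (\<beta> / l1 z)"
        "real m / real N * norm (snd w - snd z) \<le> 1 * (\<beta> / l2 z)"
        by (intro mult_mono t; use w in \<open>auto simp: cpolydisc_def\<close>)+
      then show ?thesis by (simp add: y_def cpolydisc_def)
    qed
    have y_step: "y (Suc m) \<in> cpolydisc (y m) (\<eta> / 3 / l1 (y m), \<eta> / 3 / l2 (y m))" if m: "m \<le> N" for m
    proof -
      have diff: "y (Suc m) - y m = (1 / real N) *\<^sub>R (w - z)"
        by (simp add: y_def add_divide_distrib algebra_simps)
      have small: "1 / real N * x \<le> \<eta> / 3 / l (y m)"
        if l: "l \<in> {l1, l2}" and x: "x \<le> \<beta> / l z" for l x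
      proof -
        have lp: "0 < l z" "0 < l (y m)" using l lz pos[OF sub[OF z y_in[OF m]]] by auto
        have "l (y m) / l z \<le> C" using cC(3)[OF z y_in[OF m] l] by blast
        have "3 * (\<beta> / l z) * l (y m) = 3 * \<beta> * (l (y m) / l z)" by simp
        also have "\<dots> \<le> 3 * \<beta> * C" using \<open>l (y m) / l z \<le> C\<close> \<beta> by (intro mult_left_mono) auto
        also have "\<dots> \<le> \<eta> * real N" using N \<eta> by (simp add: field_simps)
        finally have "3 * (\<beta> / l z) * l (y m) \<le> \<eta> * real N" .
        then have "1 / real N * (\<beta> / l z) \<le> \<eta> / 3 / l (y m)"
          using N0 lp by (simp add: field_simps)
        moreover have "1 / real N * x \<le> 1 / real N * (\<beta> / l z)"
          using x N0 by (intro mult_left_mono) auto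
        ultimately show ?thesis by linarith
      qed
      have "norm (fst (y (Suc m) - y m)) \<le> \<eta> / 3 / l1 (y m)"
        unfolding diff using small[of l1 "norm (fst w - fst z)"] w by (simp add: cpolydisc_def)
      moreover have "norm (snd (y (Suc m) - y m)) \<le> \<eta> / 3 / l2 (y m)"
        unfolding diff using small[of l2 "norm (snd w - snd z)"] w by (simp add: cpolydisc_def)
      ultimately show ?thesis by (simp add: cpolydisc_def)
    qed
    have "m \<le> N \<Longrightarrow> ?J (y m) \<le> K ^ m * ?J z" for m
    proof (induction m)
      case 0
      then show ?case by (simp add: y_def)
    next
      case (Suc m)
      have "?J (y (Suc m)) \<le> K * ?J (y m)"
        using Suc.prems by (intro step sub[OF z y_in] y_step) auto
      also have "\<dots> \<le> K * (K ^ m * ?J z)"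
        using Suc \<open>0 < K\<close> by (intro mult_left_mono) auto
      finally show ?case by (simp add: mult_ac)
    qed
    from this[of N] have "?J w \<le> K ^ N * ?J z" using N0 by (simp add: y_def)
    then show ?thesis using norm_le_scaled_jet[of F w l1 l2 n] by linarith
  qed
  \<comment> \<open>Cauchy's inequality at scaled radius \<open>\<beta> > 1\<close> gains
    \<open>\<beta> ^ (p + q)\<close>, which beats the fixed loss \<open>K ^ N\<close> once
    \<open>p + q \<ge> n1\<close>.\<close>
  obtain n1 where n1: "K ^ N < \<beta> ^ n1" using real_arch_pow[OF \<beta>] by blast
  define n0 where "n0 = max n n1"
  have "scaled_coeff F l1 l2 z p q \<le> scaled_jet F l1 l2 n0 z" if z: "z \<in> bidisc" for z p q
  proof (cases "p + q \<le> n0")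
    case True
    then show ?thesis by (rule scaled_coeff_le_jet)
  next
    case False
    note lz = pos[OF z]
    have "norm (tcoeff F z p q) * (\<beta> / l1 z) ^ p * (\<beta> / l2 z) ^ q \<le> K ^ N * ?J z"
      by (rule tcoeff_Cauchy_inequality[OF F z _ room(1)[OF z] _ room(2)[OF z] bound[OF z]])
         (use lz \<beta> in \<open>auto simp: torus2_def cpolydisc_def\<close>)
    then have "scaled_coeff F l1 l2 z p q * \<beta> ^ (p + q) \<le> K ^ N * ?J z"
      using scaled_coeff_conv_tcoeff[of l1 z l2, OF lz] by simp
    also have "\<dots> \<le> \<beta> ^ (p + q) * ?J z"
    proof (intro mult_right_mono scaled_jet_nonneg)
      have "\<beta> ^ n1 \<le> \<beta> ^ (p + q)" using False \<beta> by (intro power_increasing) (auto simp: n0_def)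
      with n1 show "K ^ N \<le> \<beta> ^ (p + q)" by linarith
    qed
    finally have "scaled_coeff F l1 l2 z p q \<le> ?J z"
      using \<beta> by (simp add: mult.commute)
    also have "\<dots> \<le> scaled_jet F l1 l2 n0 z" by (rule scaled_jet_mono) (simp add: n0_def)
    finally show ?thesis .
  qed
  then show ?thesis unfolding bounded_L_index_joint_iff by blast
qed

theorem theorem8:
  fixes \<beta> :: real and l1 l2 :: "complex \<times> complex \<Rightarrow> real" and F :: "complex \<times> complex \<Rightarrow> complex"
  assumes "\<beta> > 1"
    and "continuous_on bidisc l1" and "continuous_on bidisc l2"
    and "\<forall>z\<in>bidisc. l1 z > \<beta> / (1 - norm (fst z))"
    and "\<forall>z\<in>bidisc. l2 z > \<beta> / (1 - norm (snd z))"
    and "Q2 \<beta> l1 l2"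
    and "analytic2 F bidisc"
  shows "bounded_L_index_joint F l1 l2 \<longleftrightarrow>
    (\<exists>p::nat. \<forall>d. 0 < d \<and> d \<le> \<beta> \<longrightarrow>
       (\<exists>\<eta>. 0 < \<eta> \<and> \<eta> < d \<and>
          (\<forall>z0\<in>bidisc. \<exists>r k0. \<eta> < r \<and> r < d \<and> k0 \<le> p \<and>
              main_polynomial F z0 (r / l1 z0, r / l2 z0) k0)))"
proof
  assume "bounded_L_index_joint F l1 l2"
  then obtain n where n: "\<And>z p q. z \<in> bidisc \<Longrightarrow> scaled_coeff F l1 l2 z p q \<le> scaled_jet F l1 l2 n z"
    unfolding bounded_L_index_joint_iff by blast
  have l: "0 < l1 z" "0 < l2 z" if "z \<in> bidisc" for z
    using weights_pos[of \<beta> z l1 l2] assms(1,4,5) that by auto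
  \<comment> \<open>The index bound \<open>n\<close> serves as \<open>p\<close> for every
    \<open>d\<close>.\<close>
  show "\<exists>p::nat. \<forall>d. 0 < d \<and> d \<le> \<beta> \<longrightarrow>
       (\<exists>\<eta>. 0 < \<eta> \<and> \<eta> < d \<and>
          (\<forall>z0\<in>bidisc. \<exists>r k0. \<eta> < r \<and> r < d \<and> k0 \<le> p \<and>
              main_polynomial F z0 (r / l1 z0, r / l2 z0) k0))"
    using bounded_index_imp_main_polynomial[of l1 l2 F n, OF l n] by metis
next
  assume "\<exists>p::nat. \<forall>d. 0 < d \<and> d \<le> \<beta> \<longrightarrow>
       (\<exists>\<eta>. 0 < \<eta> \<and> \<eta> < d \<and>
          (\<forall>z0\<in>bidisc. \<exists>r k0. \<eta> < r \<and> r < d \<and> k0 \<le> p \<and>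
              main_polynomial F z0 (r / l1 z0, r / l2 z0) k0))"
  \<comment> \<open>The instance \<open>d = 1\<close>, admissible because
    \<open>\<beta> > 1\<close>.\<close>
  then obtain p :: nat and \<eta> :: real where "0 < \<eta>" "\<eta> < 1"
    "\<forall>z0\<in>bidisc. \<exists>r k0. \<eta> < r \<and> r < 1 \<and> k0 \<le> p \<and> main_polynomial F z0 (r / l1 z0, r / l2 z0) k0"
    using assms(1) by (metis less_imp_le zero_less_one)
  then show "bounded_L_index_joint F l1 l2"
    using assms by (intro main_polynomial_imp_bounded_index[of F \<beta> l1 l2 \<eta> p]) auto
qed

end
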